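(* Let $\Gamma$ be a group, let $p$ be a prime and let $\mathbb{F}$ be a field of characteristic $p$. Then $\mathbb{F}[\Gamma]$ is stably finite if and only if $\mathbb{F}_p[\Gamma]$ is stably finite. Thus Kaplansky's stable finiteness conjecture over $\mathbb{F}$ (that $\mathbb{F}[G]$ is stably finite for every group $G$) implies Kaplansky's stable finiteness conjecture over all fields of characteristic $p$.
   Context: A ring $R$ with identity is directly finite if for all $x,y\in R$, $xy=1$ implies $yx=1$. It is stably finite if the matrix ring $\mathbb{M}_d(R)$ is directly finite for every $d\ge1$. $\mathbb{F}_p$ is the field with $p$ elements. *)

theory Defs
  imports
    "HOL-Number_Theory.Residues"
    "Jordan_Normal_Form.Matrix"
begin

definition directly_finite :: "('a, 'm) ring_scheme \<Rightarrow> bool" where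
  "directly_finite R \<longleftrightarrow>
     (\<forall>x\<in>carrier R. \<forall>y\<in>carrier R. x \<otimes>\<^bsub>R\<^esub> y = \<one>\<^bsub>R\<^esub> \<longrightarrow> y \<otimes>\<^bsub>R\<^esub> x = \<one>\<^bsub>R\<^esub>)"

text \<open>
  The library operations on the type of matrices take the ring structure of the entries from a type
  class. Here the entries come from a ring record, so the ring of square matrices is built
  on the underlying type, with the operations of that record.
\<close>

definition matrix_ring :: "nat \<Rightarrow> ('a, 'm) ring_scheme \<Rightarrow> 'a mat ring" where
  "matrix_ring d R =
     \<lparr>carrier = {A \<in> carrier_mat d d. \<forall>i<d. \<forall>j<d. A $$ (i, j) \<in> carrier R},
      monoid.mult = (\<lambda>A B. mat d d (\<lambda>(i, j). \<Oplus>\<^bsub>R\<^esub>k\<in>{..<d}. A $$ (i, k) \<otimes>\<^bsub>R\<^esub> B $$ (k, j))),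
      one = mat d d (\<lambda>(i, j). if i = j then \<one>\<^bsub>R\<^esub> else \<zero>\<^bsub>R\<^esub>),
      zero = mat d d (\<lambda>(i, j). \<zero>\<^bsub>R\<^esub>),
      add = (\<lambda>A B. mat d d (\<lambda>(i, j). A $$ (i, j) \<oplus>\<^bsub>R\<^esub> B $$ (i, j)))\<rparr>"

definition stably_finite :: "('a, 'm) ring_scheme \<Rightarrow> bool" where
  "stably_finite R \<longleftrightarrow> (\<forall>d\<ge>1. directly_finite (matrix_ring d R))"

text \<open>
  Elements of the group ring are the finitely supported functions from the group to the
  coefficients. They are extensional, so that equality in the carrier is equality of functions.
\<close>

definition supp :: "('a, 'm) ring_scheme \<Rightarrow> ('g, 'n) monoid_scheme \<Rightarrow> ('g \<Rightarrow> 'a) \<Rightarrow> 'g set" where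
  "supp R G f = {g \<in> carrier G. f g \<noteq> \<zero>\<^bsub>R\<^esub>}"

definition group_ring ::
  "('a, 'm) ring_scheme \<Rightarrow> ('g, 'n) monoid_scheme \<Rightarrow> ('g \<Rightarrow> 'a) ring" where
  "group_ring R G =
     \<lparr>carrier = {f \<in> carrier G \<rightarrow>\<^sub>E carrier R. finite (supp R G f)},
      monoid.mult = (\<lambda>f h. \<lambda>g\<in>carrier G.
        finsum R (\<lambda>(a, b). f a \<otimes>\<^bsub>R\<^esub> h b)
          {(a, b) \<in> supp R G f \<times> supp R G h. a \<otimes>\<^bsub>G\<^esub> b = g}),
      one = (\<lambda>g\<in>carrier G. if g = \<one>\<^bsub>G\<^esub> then \<one>\<^bsub>R\<^esub> else \<zero>\<^bsub>R\<^esub>),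
      zero = (\<lambda>g\<in>carrier G. \<zero>\<^bsub>R\<^esub>),
      add = (\<lambda>f h. \<lambda>g\<in>carrier G. f g \<oplus>\<^bsub>R\<^esub> h g)\<rparr>"

definition ring_char :: "('a, 'm) ring_scheme \<Rightarrow> nat" where
  "ring_char R =
     (if \<exists>n::nat. n > 0 \<and> [n] \<cdot>\<^bsub>R\<^esub> \<one>\<^bsub>R\<^esub> = \<zero>\<^bsub>R\<^esub>
      then LEAST n::nat. n > 0 \<and> [n] \<cdot>\<^bsub>R\<^esub> \<one>\<^bsub>R\<^esub> = \<zero>\<^bsub>R\<^esub>
      else 0)"

text \<open>
  HOL cannot quantify over types inside a formula, so ``every group'' is every group whose elements
  belong to the given type, which is left arbitrary.
\<close>

definition kaplansky_stable_finiteness :: "'g itself \<Rightarrow> ('a, 'm) ring_scheme \<Rightarrow> bool" where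
  "kaplansky_stable_finiteness (_ :: 'g itself) K \<longleftrightarrow>
     (\<forall>G :: 'g monoid. group G \<longrightarrow> stably_finite (group_ring K G))"

end

theory Submission
  imports "HOL-Algebra.Finite_Extensions" Defs
begin

text \<open>
  Stable finiteness passes down from a field to a subfield, because a subring of a directly
  finite ring with the same unit is directly finite. The content of the theorem is the ascent from
  the prime field to an arbitrary field \<open>F\<close> of characteristic \<open>p\<close>.

  The ascent rests on a specialisation argument. A failure of stable finiteness of \<open>F[G]\<close> is a pair
  of square matrices over \<open>F[G]\<close> with \<open>A B = 1\<close> and \<open>B A \<noteq> 1\<close>, and it involves finitely many elements of
  \<open>F\<close>: the coefficients of \<open>A\<close> and \<open>B\<close>, and the inverse of one nonzero coefficient of \<open>B A - 1\<close>. Suppose that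
  some subring \<open>S\<close> of \<open>F\<close> containing these elements has a unital representation by \<open>n\<close> by \<open>n\<close> matrices over
  a field \<open>K\<close>, with \<open>n \<ge> 1\<close>. Replacing every coefficient by its matrix produces larger matrices over \<open>K[G]\<close>
  with the same defect, since a unit of \<open>S\<close> is not mapped to zero. Hence \<open>F[G]\<close> is stably finite
  as soon as every finite subset of \<open>F\<close> lies in a subring represented over a field \<open>K\<close> with \<open>K[G]\<close>
  stably finite (lemma \<open>stably_finite_if_locally_represented\<close>).

  By this criterion stable finiteness climbs from a subfield \<open>K\<close> of \<open>F\<close> to a subfield containing one more
  element \<open>x\<close> (lemma \<open>stably_finite_adjoin\<close>). If \<open>x\<close> is algebraic, then \<open>K[x]\<close> is a finite-dimensional
  vector space over \<open>K\<close> and acts on itself by multiplication. If \<open>x\<close> is transcendental, then a finite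
  subset of \<open>K(x)\<close> has a common denominator \<open>f(x)\<close> and lies in \<open>K[x, 1/f(x)]\<close>. In the quotient of the polynomial
  ring \<open>K[X]\<close> by \<open>1 + X f\<close> the class of \<open>f\<close> is a unit with inverse the class of \<open>- X\<close>, so
  \<open>K[x, 1/f(x)]\<close> maps to this quotient. Its dimension over \<open>K\<close> is the degree of \<open>1 + X f\<close>, which is
  finite and positive, and again it acts on itself. This choice of the modulus works over every field, finite or
  infinite, and takes the place of the Nullstellensatz.

  Every finite subset of \<open>F\<close> is therefore contained in a subfield with stably finite
  group ring, reached from the prime field in finitely many steps, and one more application of the
  criterion yields \<open>F\<close> itself. The statement on Kaplansky's conjecture follows by comparing two fields
  with their common prime field.
\<close>

section \<open>Arithmetic of group rings\<close>

lemma group_ring_add_apply: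
  "g \<in> carrier G \<Longrightarrow> (f \<oplus>\<^bsub>group_ring R G\<^esub> h) g = f g \<oplus>\<^bsub>R\<^esub> h g"
  by (simp add: group_ring_def)

lemma group_ring_carrier_iff:
  "f \<in> carrier (group_ring R G) \<longleftrightarrow> f \<in> carrier G \<rightarrow>\<^sub>E carrier R \<and> finite (supp R G f)"
  by (simp add: group_ring_def)

lemma group_ring_apply_closed:
  "f \<in> carrier (group_ring R G) \<Longrightarrow> a \<in> carrier G \<Longrightarrow> f a \<in> carrier R"
  by (auto simp: group_ring_def)

text \<open>
  The entries of a matrix product over a group ring are sums formed with \<open>finsum\<close> in the group ring;
  such sums can be evaluated pointwise only once its addition is known to be a commutative monoid.
\<close>

lemma group_ring_abelian_monoid:
  assumes "ring R"
  shows "abelian_monoid (group_ring R G)"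
proof -
  interpret ring R by fact
  show ?thesis
  proof (rule abelian_monoidI)
    fix f h assume fh: "f \<in> carrier (group_ring R G)" "h \<in> carrier (group_ring R G)"
    have "supp R G (f \<oplus>\<^bsub>group_ring R G\<^esub> h) \<subseteq> supp R G f \<union> supp R G h"
      by (auto simp: supp_def group_ring_add_apply)
    with fh show "f \<oplus>\<^bsub>group_ring R G\<^esub> h \<in> carrier (group_ring R G)"
      unfolding group_ring_carrier_iff
      by (auto intro: finite_subset simp: group_ring_def PiE_iff)
  next
    show "\<zero>\<^bsub>group_ring R G\<^esub> \<in> carrier (group_ring R G)"
      by (simp add: group_ring_def supp_def)
  qed (auto simp: group_ring_def PiE_iff extensional_def restrict_def a_ac fun_eq_iff)
qed

lemma group_ring_finsum_apply:
  assumes "ring R" "f \<in> I \<rightarrow> carrier (group_ring R G)" "g \<in> carrier G" "finite I"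
  shows "(finsum (group_ring R G) f I) g = finsum R (\<lambda>i. f i g) I"
proof -
  interpret ring R by fact
  interpret GR: abelian_monoid "group_ring R G" by (rule group_ring_abelian_monoid) fact
  show ?thesis
    using \<open>finite I\<close> \<open>f \<in> I \<rightarrow> carrier (group_ring R G)\<close>
  proof (induction I rule: finite_induct)
    case empty
    show ?case
      unfolding GR.finsum_empty using assms(3) by (simp add: group_ring_def)
  next
    case (insert i I)
    moreover have "(\<lambda>i. f i g) \<in> insert i I \<rightarrow> carrier R"
      using insert.prems assms(3) by (auto intro: group_ring_apply_closed)
    ultimately show ?case
      using assms(3) by (simp add: group_ring_add_apply Pi_def)
  qed
qed

text \<open>
  The defining sum of a product runs over the supports of the two factors. Adding zero terms allows one
  finite set \<open>T\<close> to serve for all entries of two matrices at once.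
\<close>

lemma group_ring_mult_apply:
  assumes "ring R" and f: "f \<in> carrier (group_ring R G)" and h: "h \<in> carrier (group_ring R G)"
    and "g \<in> carrier G" "finite T" "supp R G f \<subseteq> T" "supp R G h \<subseteq> T" "T \<subseteq> carrier G"
  shows "(f \<otimes>\<^bsub>group_ring R G\<^esub> h) g =
         finsum R (\<lambda>(a, b). f a \<otimes>\<^bsub>R\<^esub> h b) {(a, b) \<in> T \<times> T. a \<otimes>\<^bsub>G\<^esub> b = g}"
proof -
  interpret ring R by fact
  have "finsum R (\<lambda>(a, b). f a \<otimes>\<^bsub>R\<^esub> h b) {(a, b) \<in> supp R G f \<times> supp R G h. a \<otimes>\<^bsub>G\<^esub> b = g}
      = finsum R (\<lambda>(a, b). f a \<otimes>\<^bsub>R\<^esub> h b) {(a, b) \<in> T \<times> T. a \<otimes>\<^bsub>G\<^esub> b = g}"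
  proof (rule add.finprod_mono_neutral_cong_left)
    show "finite {(a, b) \<in> T \<times> T. a \<otimes>\<^bsub>G\<^esub> b = g}"
      using \<open>finite T\<close> by (auto intro: finite_subset[of _ "T \<times> T"])
    show "(\<lambda>(a, b). f a \<otimes>\<^bsub>R\<^esub> h b) \<in> {(a, b) \<in> T \<times> T. a \<otimes>\<^bsub>G\<^esub> b = g} \<rightarrow> carrier R"
      using group_ring_apply_closed[OF f] group_ring_apply_closed[OF h] \<open>T \<subseteq> carrier G\<close>
      by (auto simp: subset_iff)
    show "(case x of (a, b) \<Rightarrow> f a \<otimes>\<^bsub>R\<^esub> h b) = \<zero>\<^bsub>R\<^esub>"
      if x: "x \<in> {(a, b) \<in> T \<times> T. a \<otimes>\<^bsub>G\<^esub> b = g} -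
              {(a, b) \<in> supp R G f \<times> supp R G h. a \<otimes>\<^bsub>G\<^esub> b = g}" for x
    proof -
      obtain a b where "x = (a, b)" "a \<in> carrier G" "b \<in> carrier G"
        and "f a = \<zero>\<^bsub>R\<^esub> \<or> h b = \<zero>\<^bsub>R\<^esub>"
        using x \<open>T \<subseteq> carrier G\<close> by (cases x) (auto simp: supp_def)
      then show ?thesis
        using group_ring_apply_closed[OF f] group_ring_apply_closed[OF h] by auto
    qed
  qed (use assms in auto)
  with \<open>g \<in> carrier G\<close> show ?thesis by (simp add: group_ring_def)
qed

lemma group_ring_mult_closed:
  assumes "ring R" "monoid G"
    and f: "f \<in> carrier (group_ring R G)" and h: "h \<in> carrier (group_ring R G)"
  shows "f \<otimes>\<^bsub>group_ring R G\<^esub> h \<in> carrier (group_ring R G)"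
proof -
  interpret ring R by fact
  interpret G: monoid G by fact
  define T where "T = supp R G f \<union> supp R G h"
  have T: "finite T" "supp R G f \<subseteq> T" "supp R G h \<subseteq> T" "T \<subseteq> carrier G"
    using f h by (auto simp: T_def group_ring_carrier_iff supp_def)
  note apply_T = group_ring_mult_apply[OF \<open>ring R\<close> f h _ T]
  have "supp R G (f \<otimes>\<^bsub>group_ring R G\<^esub> h) \<subseteq> (\<lambda>(a, b). a \<otimes>\<^bsub>G\<^esub> b) ` (T \<times> T)"
  proof
    fix g assume g: "g \<in> supp R G (f \<otimes>\<^bsub>group_ring R G\<^esub> h)"
    then have gG: "g \<in> carrier G" and nz: "(f \<otimes>\<^bsub>group_ring R G\<^esub> h) g \<noteq> \<zero>\<^bsub>R\<^esub>"
      by (auto simp: supp_def)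
    have "{(a, b) \<in> T \<times> T. a \<otimes>\<^bsub>G\<^esub> b = g} \<noteq> {}"
    proof
      assume "{(a, b) \<in> T \<times> T. a \<otimes>\<^bsub>G\<^esub> b = g} = {}"
      with nz show False unfolding apply_T[OF gG] by (simp only: add.finprod_empty simp_thms)
    qed
    then show "g \<in> (\<lambda>(a, b). a \<otimes>\<^bsub>G\<^esub> b) ` (T \<times> T)" by auto
  qed
  then have "finite (supp R G (f \<otimes>\<^bsub>group_ring R G\<^esub> h))"
    by (rule finite_subset) (use T in auto)
  moreover have "(f \<otimes>\<^bsub>group_ring R G\<^esub> h) g \<in> carrier R" if "g \<in> carrier G" for g
    unfolding apply_T[OF that]
    using group_ring_apply_closed[OF f] group_ring_apply_closed[OF h] \<open>T \<subseteq> carrier G\<close>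
    by (intro finsum_closed) (auto simp: subset_iff)
  moreover have "f \<otimes>\<^bsub>group_ring R G\<^esub> h \<in> extensional (carrier G)"
    by (simp add: group_ring_def)
  ultimately show ?thesis by (simp add: group_ring_carrier_iff PiE_iff)
qed

section \<open>Stable finiteness in terms of coefficients\<close>

text \<open>
  Coefficient of the group element \<open>g\<close> in the entry \<open>(i, j)\<close> of the product of two \<open>d\<close> by \<open>d\<close> matrices over
  the group ring, where \<open>A i j g\<close> is the coefficient of \<open>g\<close> in the entry \<open>(i, j)\<close> of the first matrix
  and all supports lie in \<open>T\<close>. Values outside \<open>T\<close> are ignored, so arbitrary functions encode matrices.
\<close>

definition conv ::
  "('a, 'm) ring_scheme \<Rightarrow> ('g, 'n) monoid_scheme \<Rightarrow> 'g set \<Rightarrow> nat \<Rightarrow>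
   (nat \<Rightarrow> nat \<Rightarrow> 'g \<Rightarrow> 'a) \<Rightarrow> (nat \<Rightarrow> nat \<Rightarrow> 'g \<Rightarrow> 'a) \<Rightarrow> nat \<Rightarrow> nat \<Rightarrow> 'g \<Rightarrow> 'a" where
  "conv R G T d A B i j g =
     finsum R (\<lambda>k. finsum R (\<lambda>(a, b). A i k a \<otimes>\<^bsub>R\<^esub> B k j b) {(a, b) \<in> T \<times> T. a \<otimes>\<^bsub>G\<^esub> b = g}) {..<d}"

definition conv_one ::
  "('a, 'm) ring_scheme \<Rightarrow> ('g, 'n) monoid_scheme \<Rightarrow> 'g set \<Rightarrow> nat \<Rightarrow>
   (nat \<Rightarrow> nat \<Rightarrow> 'g \<Rightarrow> 'a) \<Rightarrow> (nat \<Rightarrow> nat \<Rightarrow> 'g \<Rightarrow> 'a) \<Rightarrow> bool" where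
  "conv_one R G T d A B \<longleftrightarrow>
     (\<forall>i<d. \<forall>j<d. \<forall>g\<in>carrier G. conv R G T d A B i j g = (if i = j \<and> g = \<one>\<^bsub>G\<^esub> then \<one>\<^bsub>R\<^esub> else \<zero>\<^bsub>R\<^esub>))"

definition coeff_family ::
  "('a, 'm) ring_scheme \<Rightarrow> 'g set \<Rightarrow> nat \<Rightarrow> (nat \<Rightarrow> nat \<Rightarrow> 'g \<Rightarrow> 'a) \<Rightarrow> bool" where
  "coeff_family R T d A \<longleftrightarrow> (\<forall>i<d. \<forall>j<d. \<forall>g\<in>T. A i j g \<in> carrier R)"

lemma conv_cong:
  assumes "ring R" "coeff_family R T d A" "coeff_family R T d B" "i < d" "j < d"
    and "\<And>i j g. i < d \<Longrightarrow> j < d \<Longrightarrow> g \<in> T \<Longrightarrow> A' i j g = A i j g"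
    and "\<And>i j g. i < d \<Longrightarrow> j < d \<Longrightarrow> g \<in> T \<Longrightarrow> B' i j g = B i j g"
  shows "conv R G T d A' B' i j g = conv R G T d A B i j g"
proof -
  interpret ring R by fact
  show ?thesis unfolding conv_def
    by (intro finsum_cong' refl funcsetI finsum_closed)
      (use assms in \<open>auto simp: coeff_family_def\<close>)
qed

lemma matrix_ring_carrierD:
  assumes "U \<in> carrier (matrix_ring d R)"
  shows "U \<in> carrier_mat d d" "\<And>i j. i < d \<Longrightarrow> j < d \<Longrightarrow> U $$ (i, j) \<in> carrier R"
  using assms by (auto simp: matrix_ring_def)

lemma matrix_group_ring_mult_eq_one_iff:
  assumes "ring R" "monoid G"
    and U: "U \<in> carrier (matrix_ring d (group_ring R G))"
    and V: "V \<in> carrier (matrix_ring d (group_ring R G))"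
    and T: "finite T" "T \<subseteq> carrier G"
    and suppU: "\<And>i j. i < d \<Longrightarrow> j < d \<Longrightarrow> supp R G (U $$ (i, j)) \<subseteq> T"
    and suppV: "\<And>i j. i < d \<Longrightarrow> j < d \<Longrightarrow> supp R G (V $$ (i, j)) \<subseteq> T"
  shows "U \<otimes>\<^bsub>matrix_ring d (group_ring R G)\<^esub> V = \<one>\<^bsub>matrix_ring d (group_ring R G)\<^esub> \<longleftrightarrow>
         conv_one R G T d (\<lambda>i j. U $$ (i, j)) (\<lambda>i j. V $$ (i, j))"
proof -
  interpret ring R by fact
  interpret G: monoid G by fact
  interpret GR: abelian_monoid "group_ring R G" by (rule group_ring_abelian_monoid) fact
  define P where "P = U \<otimes>\<^bsub>matrix_ring d (group_ring R G)\<^esub> V"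
  define I where "I = \<one>\<^bsub>matrix_ring d (group_ring R G)\<^esub>"
  note U' = matrix_ring_carrierD[OF U] and V' = matrix_ring_carrierD[OF V]
  have terms: "(\<lambda>k. U $$ (i, k) \<otimes>\<^bsub>group_ring R G\<^esub> V $$ (k, j)) \<in> {..<d} \<rightarrow> carrier (group_ring R G)"
    if "i < d" "j < d" for i j
    using that U' V' by (auto intro!: group_ring_mult_closed[OF assms(1,2)])
  have P: "P $$ (i, j) = finsum (group_ring R G) (\<lambda>k. U $$ (i, k) \<otimes>\<^bsub>group_ring R G\<^esub> V $$ (k, j)) {..<d}"
    if "i < d" "j < d" for i j
    using that by (simp add: P_def matrix_ring_def)
  have P_apply: "(P $$ (i, j)) g = conv R G T d (\<lambda>i j. U $$ (i, j)) (\<lambda>i j. V $$ (i, j)) i j g"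
    if "i < d" "j < d" "g \<in> carrier G" for i j g
    unfolding P[OF that(1,2)] conv_def group_ring_finsum_apply[OF assms(1) terms[OF that(1,2)] that(3) finite_lessThan]
  proof (intro finsum_cong' refl funcsetI finsum_closed)
    fix k assume "k \<in> {..<d}"
    then show "(U $$ (i, k) \<otimes>\<^bsub>group_ring R G\<^esub> V $$ (k, j)) g =
        finsum R (\<lambda>(a, b). (U $$ (i, k)) a \<otimes>\<^bsub>R\<^esub> (V $$ (k, j)) b) {(a, b) \<in> T \<times> T. a \<otimes>\<^bsub>G\<^esub> b = g}"
      using that U' V' T suppU suppV by (intro group_ring_mult_apply[OF assms(1)]) auto
  next
    fix k x assume "k \<in> {..<d}" "x \<in> {(a, b) \<in> T \<times> T. a \<otimes>\<^bsub>G\<^esub> b = g}"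
    then show "(case x of (a, b) \<Rightarrow> (U $$ (i, k)) a \<otimes>\<^bsub>R\<^esub> (V $$ (k, j)) b) \<in> carrier R"
      using that U'(2)[of i k] V'(2)[of k j] T(2)
      by (auto simp: subset_iff intro!: group_ring_apply_closed[of _ R G] m_closed)
  qed
  have ext: "P $$ (i, j) \<in> extensional (carrier G)" if "i < d" "j < d" for i j
    unfolding P[OF that] using GR.finsum_closed[OF terms[OF that]]
    by (simp add: group_ring_carrier_iff PiE_iff)
  have I_apply: "(I $$ (i, j)) g = (if i = j \<and> g = \<one>\<^bsub>G\<^esub> then \<one>\<^bsub>R\<^esub> else \<zero>\<^bsub>R\<^esub>)"
    if "i < d" "j < d" "g \<in> carrier G" for i j g
    using that by (simp add: I_def matrix_ring_def group_ring_def)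
  have extI: "I $$ (i, j) \<in> extensional (carrier G)" if "i < d" "j < d" for i j
    using that by (simp add: I_def matrix_ring_def group_ring_def)
  have "P = I \<longleftrightarrow> (\<forall>i<d. \<forall>j<d. P $$ (i, j) = I $$ (i, j))"
    by (auto simp: P_def I_def matrix_ring_def mat_eq_iff)
  also have "\<dots> \<longleftrightarrow> (\<forall>i<d. \<forall>j<d. \<forall>g\<in>carrier G. (P $$ (i, j)) g = (I $$ (i, j)) g)"
    using ext extI by (metis extensionalityI)
  also have "\<dots> \<longleftrightarrow> conv_one R G T d (\<lambda>i j. U $$ (i, j)) (\<lambda>i j. V $$ (i, j))"
    by (simp add: conv_one_def P_apply I_apply)
  finally show ?thesis unfolding P_def I_def .
qed

text \<open>
  Stable finiteness of a group ring is a family of statements about finite systems of bilinear equations in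
  the coefficient ring. This is the form in which coefficients can be replaced by matrices.
\<close>

lemma stably_finite_group_ring_iff:
  assumes "ring R" "monoid G"
  shows "stably_finite (group_ring R G) \<longleftrightarrow>
    (\<forall>d\<ge>1. \<forall>T A B. finite T \<longrightarrow> T \<subseteq> carrier G \<longrightarrow> coeff_family R T d A \<longrightarrow> coeff_family R T d B \<longrightarrow>
       conv_one R G T d A B \<longrightarrow> conv_one R G T d B A)"
proof (intro iffI allI impI)
  interpret ring R by fact
  fix d T A B
  assume sf: "stably_finite (group_ring R G)" and d: "(d::nat) \<ge> 1"
    and T: "finite T" "T \<subseteq> carrier G"
    and A: "coeff_family R T d A" and B: "coeff_family R T d B" and one: "conv_one R G T d A B"
  define M where "M A = mat d d (\<lambda>(i, j). \<lambda>g\<in>carrier G. if g \<in> T then A i j g else \<zero>\<^bsub>R\<^esub>)"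
    for A :: "nat \<Rightarrow> nat \<Rightarrow> 'c \<Rightarrow> 'a"
  have M_apply: "(M A $$ (i, j)) g = A i j g" if "i < d" "j < d" "g \<in> T" for A i j g
    using that T by (auto simp: M_def)
  have M_supp: "supp R G (M A $$ (i, j)) \<subseteq> T" if "i < d" "j < d" for A i j
    using that by (auto simp: M_def supp_def split: if_splits)
  have M_carrier: "M A \<in> carrier (matrix_ring d (group_ring R G))" if "coeff_family R T d A" for A
  proof -
    have "finite (supp R G (M A $$ (i, j)))" if "i < d" "j < d" for i j
      using M_supp[OF that] T(1) finite_subset by blast
    moreover have "M A $$ (i, j) \<in> carrier G \<rightarrow>\<^sub>E carrier R" if "i < d" "j < d" for i j
      using that \<open>coeff_family R T d A\<close> by (auto simp: M_def coeff_family_def)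
    ultimately show ?thesis
      unfolding matrix_ring_def by (auto simp: group_ring_carrier_iff) (simp_all add: M_def)
  qed
  have iff: "conv_one R G T d A B \<longleftrightarrow>
      M A \<otimes>\<^bsub>matrix_ring d (group_ring R G)\<^esub> M B = \<one>\<^bsub>matrix_ring d (group_ring R G)\<^esub>"
    if "coeff_family R T d A" "coeff_family R T d B" for A B
  proof -
    have eq: "conv R G T d (\<lambda>i j. M A $$ (i, j)) (\<lambda>i j. M B $$ (i, j)) i j g = conv R G T d A B i j g"
      if "i < d" "j < d" for i j g
      by (rule conv_cong[OF \<open>ring R\<close> \<open>coeff_family R T d A\<close> \<open>coeff_family R T d B\<close> that])
        (simp_all add: M_apply)
    have "conv_one R G T d (\<lambda>i j. M A $$ (i, j)) (\<lambda>i j. M B $$ (i, j)) \<longleftrightarrow> conv_one R G T d A B"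
      unfolding conv_one_def by (simp add: eq)
    then show ?thesis
      using matrix_group_ring_mult_eq_one_iff[OF assms M_carrier M_carrier T M_supp M_supp] that
      by auto
  qed
  show "conv_one R G T d B A"
    using sf d one M_carrier[OF A] M_carrier[OF B]
    unfolding iff[OF A B] iff[OF B A] stably_finite_def directly_finite_def by blast
next
  assume R: "\<forall>d\<ge>1. \<forall>T A B. finite T \<longrightarrow> T \<subseteq> carrier G \<longrightarrow> coeff_family R T d A \<longrightarrow>
       coeff_family R T d B \<longrightarrow> conv_one R G T d A B \<longrightarrow> conv_one R G T d B A"
  show "stably_finite (group_ring R G)"
    unfolding stably_finite_def directly_finite_def
  proof (intro allI impI ballI)
    fix d U V
    assume d: "(d::nat) \<ge> 1"
      and U: "U \<in> carrier (matrix_ring d (group_ring R G))"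
      and V: "V \<in> carrier (matrix_ring d (group_ring R G))"
      and one: "U \<otimes>\<^bsub>matrix_ring d (group_ring R G)\<^esub> V = \<one>\<^bsub>matrix_ring d (group_ring R G)\<^esub>"
    define T where "T = (\<Union>i<d. \<Union>j<d. supp R G (U $$ (i, j)) \<union> supp R G (V $$ (i, j)))"
    note U' = matrix_ring_carrierD[OF U] and V' = matrix_ring_carrierD[OF V]
    have T: "finite T" "T \<subseteq> carrier G"
      using U' V' by (auto simp: T_def group_ring_carrier_iff supp_def)
    have s: "supp R G (U $$ (i, j)) \<subseteq> T" "supp R G (V $$ (i, j)) \<subseteq> T" if "i < d" "j < d" for i j
      using that by (auto simp: T_def)
    have "coeff_family R T d (\<lambda>i j. U $$ (i, j))" "coeff_family R T d (\<lambda>i j. V $$ (i, j))"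
      using U'(2) V'(2) T(2) by (auto simp: coeff_family_def subset_iff intro!: group_ring_apply_closed[of _ R G])
    with R d T one show "V \<otimes>\<^bsub>matrix_ring d (group_ring R G)\<^esub> U = \<one>\<^bsub>matrix_ring d (group_ring R G)\<^esub>"
      using matrix_group_ring_mult_eq_one_iff[OF assms U V T s]
        matrix_group_ring_mult_eq_one_iff[OF assms V U T s(2,1)] by blast
  qed
qed

section \<open>Matrix representations of the coefficients\<close>

text \<open>
  The index set of a matrix of size \<open>d * n\<close> consists of \<open>d\<close> blocks of length \<open>n\<close>.
\<close>

lemma (in abelian_monoid) finsum_lessThan_mult:
  fixes d n :: nat
  assumes "\<And>k l. k < d \<Longrightarrow> l < n \<Longrightarrow> f k l \<in> carrier G"
  shows "finsum G (\<lambda>m. f (m div n) (m mod n)) {..<d * n} =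
         finsum G (\<lambda>k. finsum G (f k) {..<n}) {..<d}"
  using assms
proof (induction d)
  case 0
  then show ?case by simp
next
  case (Suc d)
  let ?f = "\<lambda>m. f (m div n) (m mod n)"
  let ?B = "(\<lambda>l. d * n + l) ` {..<n}"
  have split: "{..<Suc d * n} = {..<d * n} \<union> ?B"
  proof (intro equalityI subsetI)
    fix m assume "m \<in> {..<Suc d * n}"
    then show "m \<in> {..<d * n} \<union> ?B"
      by (cases "m < d * n") (auto intro!: image_eqI[of _ _ "m - d * n"])
  qed auto
  have div_mod: "(d * n + l) div n = d" "(d * n + l) mod n = l" if "l < n" for l
    using that by auto
  have low: "?f \<in> {..<d * n} \<rightarrow> carrier G"
  proof
    fix m assume m: "m \<in> {..<d * n}"
    then have "n > 0" by (cases n) auto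
    with m show "?f m \<in> carrier G"
      by (intro Suc.prems) (auto simp: less_mult_imp_div_less less_Suc_eq)
  qed
  have high: "?f \<in> ?B \<rightarrow> carrier G"
    using Suc.prems div_mod by auto
  have "finsum G ?f {..<Suc d * n} = finsum G ?f {..<d * n} \<oplus> finsum G ?f ?B"
    unfolding split by (rule finsum_Un_disjoint) (use low high in auto)
  also have "finsum G ?f ?B = finsum G (\<lambda>l. ?f (d * n + l)) {..<n}"
    by (rule finsum_reindex[OF high]) (auto simp: inj_on_def)
  also have "\<dots> = finsum G (f d) {..<n}"
    by (rule finsum_cong') (use div_mod Suc.prems in auto)
  also have "finsum G ?f {..<d * n} = finsum G (\<lambda>k. finsum G (f k) {..<n}) {..<d}"
    using Suc by simp
  also have "\<dots> \<oplus> finsum G (f d) {..<n} = finsum G (\<lambda>k. finsum G (f k) {..<n}) {..<Suc d}"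
    using Suc.prems by (simp add: lessThan_Suc a_comm Pi_def)
  finally show ?case .
qed

lemma (in abelian_monoid) finsum_swap:
  assumes "finite I" "finite J" "\<And>i j. i \<in> I \<Longrightarrow> j \<in> J \<Longrightarrow> f i j \<in> carrier G"
  shows "finsum G (\<lambda>i. finsum G (\<lambda>j. f i j) J) I = finsum G (\<lambda>j. finsum G (\<lambda>i. f i j) I) J"
  using assms(1,3)
proof (induction I rule: finite_induct)
  case empty
  then show ?case by simp
next
  case (insert i I)
  have "finsum G (\<lambda>j. f i j \<oplus> finsum G (\<lambda>i. f i j) I) J =
      finsum G (f i) J \<oplus> finsum G (\<lambda>j. finsum G (\<lambda>i. f i j) I) J"
    by (rule finsum_addf) (use insert.prems in \<open>auto intro!: finsum_closed\<close>)
  moreover have "finsum G (\<lambda>j. finsum G (\<lambda>i. f i j) (insert i I)) J =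
      finsum G (\<lambda>j. f i j \<oplus> finsum G (\<lambda>i. f i j) I) J"
    by (rule finsum_cong') (use insert in \<open>auto simp: Pi_def\<close>)
  ultimately show ?case
    using insert by (simp add: Pi_def)
qed

text \<open>
  A unital ring homomorphism from \<open>S\<close> to the \<open>n\<close> by \<open>n\<close> matrices over \<open>K\<close>, given by its matrix entries. Working with
  entries keeps all computations in \<open>K\<close>, without a ring structure on matrices.
\<close>

definition matrix_rep ::
  "('a, 'm) ring_scheme \<Rightarrow> ('b, 'n) ring_scheme \<Rightarrow> nat \<Rightarrow> ('a \<Rightarrow> nat \<Rightarrow> nat \<Rightarrow> 'b) \<Rightarrow> bool" where
  "matrix_rep S K n \<rho> \<longleftrightarrow>
     (\<forall>a\<in>carrier S. \<forall>i<n. \<forall>j<n. \<rho> a i j \<in> carrier K) \<and>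
     (\<forall>a\<in>carrier S. \<forall>b\<in>carrier S. \<forall>i<n. \<forall>j<n. \<rho> (a \<oplus>\<^bsub>S\<^esub> b) i j = \<rho> a i j \<oplus>\<^bsub>K\<^esub> \<rho> b i j) \<and>
     (\<forall>a\<in>carrier S. \<forall>b\<in>carrier S. \<forall>i<n. \<forall>j<n.
        \<rho> (a \<otimes>\<^bsub>S\<^esub> b) i j = finsum K (\<lambda>k. \<rho> a i k \<otimes>\<^bsub>K\<^esub> \<rho> b k j) {..<n}) \<and>
     (\<forall>i<n. \<forall>j<n. \<rho> \<one>\<^bsub>S\<^esub> i j = (if i = j then \<one>\<^bsub>K\<^esub> else \<zero>\<^bsub>K\<^esub>))"

locale matrix_representation = S: ring S + K: ring K
  for S :: "('a, 'm) ring_scheme" and K :: "('b, 'n) ring_scheme" +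
  fixes n :: nat and \<rho> :: "'a \<Rightarrow> nat \<Rightarrow> nat \<Rightarrow> 'b"
  assumes rep: "matrix_rep S K n \<rho>"
begin

lemma rep_closed: "a \<in> carrier S \<Longrightarrow> i < n \<Longrightarrow> j < n \<Longrightarrow> \<rho> a i j \<in> carrier K"
  and rep_add: "a \<in> carrier S \<Longrightarrow> b \<in> carrier S \<Longrightarrow> i < n \<Longrightarrow> j < n \<Longrightarrow>
      \<rho> (a \<oplus>\<^bsub>S\<^esub> b) i j = \<rho> a i j \<oplus>\<^bsub>K\<^esub> \<rho> b i j"
  and rep_mult: "a \<in> carrier S \<Longrightarrow> b \<in> carrier S \<Longrightarrow> i < n \<Longrightarrow> j < n \<Longrightarrow>
      \<rho> (a \<otimes>\<^bsub>S\<^esub> b) i j = finsum K (\<lambda>k. \<rho> a i k \<otimes>\<^bsub>K\<^esub> \<rho> b k j) {..<n}"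
  and rep_one: "i < n \<Longrightarrow> j < n \<Longrightarrow> \<rho> \<one>\<^bsub>S\<^esub> i j = (if i = j then \<one>\<^bsub>K\<^esub> else \<zero>\<^bsub>K\<^esub>)"
  using rep by (simp_all add: matrix_rep_def)

lemma rep_zero:
  assumes "i < n" "j < n"
  shows "\<rho> \<zero>\<^bsub>S\<^esub> i j = \<zero>\<^bsub>K\<^esub>"
proof -
  have "\<rho> \<zero>\<^bsub>S\<^esub> i j \<oplus>\<^bsub>K\<^esub> \<rho> \<zero>\<^bsub>S\<^esub> i j = \<rho> \<zero>\<^bsub>S\<^esub> i j"
    using rep_add[of "\<zero>\<^bsub>S\<^esub>" "\<zero>\<^bsub>S\<^esub>"] assms by simp
  then show ?thesis
    using rep_closed[OF S.zero_closed assms] by (metis K.add.r_cancel_one')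
qed

lemma rep_finsum:
  assumes "finite I" "f \<in> I \<rightarrow> carrier S" "i < n" "j < n"
  shows "\<rho> (finsum S f I) i j = finsum K (\<lambda>x. \<rho> (f x) i j) I"
  using assms(1,2)
  by (induction I rule: finite_induct) (simp_all add: rep_zero rep_add rep_closed assms(3,4) Pi_def)

definition blocks :: "(nat \<Rightarrow> nat \<Rightarrow> 'g \<Rightarrow> 'a) \<Rightarrow> nat \<Rightarrow> nat \<Rightarrow> 'g \<Rightarrow> 'b" where
  "blocks A i j g = \<rho> (A (i div n) (j div n) g) (i mod n) (j mod n)"

lemma block_index:
  assumes "i < d * n"
  shows "i div n < d" "i mod n < n"
proof -
  have "n > 0" using assms by (cases n) auto
  then show "i div n < d" "i mod n < n"
    using assms by (auto simp: less_mult_imp_div_less)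
qed

lemma blocks_coeff_family:
  "coeff_family S T d A \<Longrightarrow> coeff_family K T (d * n) (blocks A)"
  using block_index by (auto simp: coeff_family_def blocks_def intro!: rep_closed)

lemma conv_closed:
  assumes "coeff_family S T d A" "coeff_family S T d B" "i < d" "j < d"
  shows "conv S G T d A B i j g \<in> carrier S"
  unfolding conv_def using assms
  by (intro S.finsum_closed funcsetI) (auto simp: coeff_family_def)

text \<open>
  Replacing every coefficient by its matrix is multiplicative. The inner index of the large product
  splits into a block index and a position in the block; the sum over positions is the matrix product of
  two representing matrices, which \<open>\<rho>\<close> turns into a product of coefficients.
\<close>

lemma conv_blocks:
  assumes A: "coeff_family S T d A" and B: "coeff_family S T d B" and "finite T"
    and i: "i < d * n" and j: "j < d * n"
  shows "conv K G T (d * n) (blocks A) (blocks B) i j g =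
         \<rho> (conv S G T d A B (i div n) (j div n) g) (i mod n) (j mod n)"
proof -
  define Q where "Q = {(a, b) \<in> T \<times> T. a \<otimes>\<^bsub>G\<^esub> b = g}"
  have "finite Q"
    using \<open>finite T\<close> by (auto simp: Q_def intro: finite_subset[of _ "T \<times> T"])
  note i' = block_index[OF i] and j' = block_index[OF j]
  define \<alpha> where "\<alpha> k l x = \<rho> (A (i div n) k (fst x)) (i mod n) l \<otimes>\<^bsub>K\<^esub> \<rho> (B k (j div n) (snd x)) l (j mod n)"
    for k l x
  have AS: "A (i div n) k (fst x) \<in> carrier S" and BS: "B k (j div n) (snd x) \<in> carrier S"
    if "k < d" "x \<in> Q" for k x
    using A B that i' j' by (auto simp: coeff_family_def Q_def)
  have \<alpha>: "\<alpha> k l x \<in> carrier K" if "k < d" "l < n" "x \<in> Q" for k l x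
    unfolding \<alpha>_def using AS BS that i' j' by (intro K.m_closed rep_closed) auto
  have "conv K G T (d * n) (blocks A) (blocks B) i j g =
      finsum K (\<lambda>m. finsum K (\<alpha> (m div n) (m mod n)) Q) {..<d * n}"
    unfolding conv_def Q_def[symmetric]
    by (intro K.finsum_cong' refl funcsetI K.finsum_closed)
      (auto simp: blocks_def \<alpha>_def split_beta block_index block_index(2)[of _ d] intro!: K.m_closed rep_closed AS BS i' j')
  also have "\<dots> = finsum K (\<lambda>k. finsum K (\<lambda>l. finsum K (\<alpha> k l) Q) {..<n}) {..<d}"
    by (rule K.finsum_lessThan_mult) (use \<alpha> in \<open>auto intro!: K.finsum_closed\<close>)
  also have "\<dots> = finsum K (\<lambda>k. finsum K (\<lambda>x. finsum K (\<lambda>l. \<alpha> k l x) {..<n}) Q) {..<d}"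
    by (intro K.finsum_cong' refl funcsetI K.finsum_swap K.finsum_closed)
      (use \<alpha> \<open>finite Q\<close> in auto)
  also have "\<dots> = finsum K (\<lambda>k. finsum K (\<lambda>x.
      \<rho> (A (i div n) k (fst x) \<otimes>\<^bsub>S\<^esub> B k (j div n) (snd x)) (i mod n) (j mod n)) Q) {..<d}"
    by (intro K.finsum_cong' refl funcsetI K.finsum_closed)
      (use AS BS i' j' in \<open>auto simp: \<alpha>_def rep_mult intro!: rep_closed K.finsum_closed\<close>)
  also have "\<dots> = finsum K (\<lambda>k. \<rho> (finsum S (\<lambda>x. A (i div n) k (fst x) \<otimes>\<^bsub>S\<^esub> B k (j div n) (snd x)) Q)
      (i mod n) (j mod n)) {..<d}"
    by (intro K.finsum_cong' refl funcsetI rep_finsum[symmetric] rep_closed)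
      (use AS BS i' j' \<open>finite Q\<close> in \<open>auto intro!: S.finsum_closed\<close>)
  also have "\<dots> = \<rho> (finsum S (\<lambda>k. finsum S (\<lambda>x. A (i div n) k (fst x) \<otimes>\<^bsub>S\<^esub> B k (j div n) (snd x)) Q) {..<d})
      (i mod n) (j mod n)"
    by (rule rep_finsum[symmetric]) (use AS BS i' j' in \<open>auto intro!: S.finsum_closed\<close>)
  finally show ?thesis
    unfolding conv_def Q_def[symmetric] by (simp add: case_prod_unfold)
qed

lemma one_blocks:
  assumes "i < d * n" "j < d * n"
  shows "\<rho> (if i div n = j div n \<and> g then \<one>\<^bsub>S\<^esub> else \<zero>\<^bsub>S\<^esub>) (i mod n) (j mod n) =
         (if i = j \<and> g then \<one>\<^bsub>K\<^esub> else \<zero>\<^bsub>K\<^esub>)"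
proof -
  have "i = j \<longleftrightarrow> i div n = j div n \<and> i mod n = j mod n"
    by (metis div_mult_mod_eq)
  then show ?thesis
    using block_index[OF assms(1)] block_index[OF assms(2)] by (auto simp: rep_one rep_zero)
qed

text \<open>
  A unit has nonzero image. This replaces injectivity of \<open>\<rho>\<close>: it suffices that the
  inverse of an element that must not vanish belongs to the represented ring.
\<close>

lemma rep_unit_not_zero:
  assumes "n \<ge> 1" "\<one>\<^bsub>K\<^esub> \<noteq> \<zero>\<^bsub>K\<^esub>"
    and w: "w \<in> carrier S" "v \<in> carrier S" "w \<otimes>\<^bsub>S\<^esub> v = \<one>\<^bsub>S\<^esub>"
    and "\<And>i j. i < n \<Longrightarrow> j < n \<Longrightarrow> \<rho> w i j = \<zero>\<^bsub>K\<^esub>"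
  shows False
proof -
  have "finsum K (\<lambda>k. \<rho> w 0 k \<otimes>\<^bsub>K\<^esub> \<rho> v k 0) {..<n} = \<zero>\<^bsub>K\<^esub>"
    by (rule K.add.finprod_one_eqI) (use assms rep_closed in auto)
  then show False
    using rep_mult[OF w(1,2), of 0 0] rep_one[of 0 0] assms by simp
qed

text \<open>
  If \<open>B\<close> is a right inverse of \<open>A\<close>, then the block matrix of \<open>B\<close> is a right inverse of that of \<open>A\<close>, hence also
  a left inverse by stable finiteness over \<open>K\<close>. Reading off the block in position \<open>(i, j)\<close> shows that \<open>\<rho>\<close>
  does not distinguish \<open>B A\<close> from the identity.
\<close>

lemma rep_conv_commute:
  assumes "monoid G" "stably_finite (group_ring K G)" "n \<ge> 1" "d \<ge> 1"
    and T: "finite T" "T \<subseteq> carrier G"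
    and A: "coeff_family S T d A" and B: "coeff_family S T d B" and one: "conv_one S G T d A B"
    and ij: "i < d" "j < d" and g: "g \<in> carrier G" and uv: "u < n" "v < n"
  shows "\<rho> (conv S G T d B A i j g) u v = \<rho> (if i = j \<and> g = \<one>\<^bsub>G\<^esub> then \<one>\<^bsub>S\<^esub> else \<zero>\<^bsub>S\<^esub>) u v"
proof -
  have "conv_one K G T (d * n) (blocks A) (blocks B)"
    unfolding conv_one_def
  proof (intro allI impI ballI)
    fix i j g assume ij: "i < d * n" "j < d * n" and g: "g \<in> carrier G"
    then have "conv S G T d A B (i div n) (j div n) g =
        (if i div n = j div n \<and> g = \<one>\<^bsub>G\<^esub> then \<one>\<^bsub>S\<^esub> else \<zero>\<^bsub>S\<^esub>)"
      using one block_index by (simp add: conv_one_def)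
    then show "conv K G T (d * n) (blocks A) (blocks B) i j g = (if i = j \<and> g = \<one>\<^bsub>G\<^esub> then \<one>\<^bsub>K\<^esub> else \<zero>\<^bsub>K\<^esub>)"
      by (simp only: conv_blocks[OF A B T(1) ij] one_blocks[OF ij])
  qed
  moreover have "d * n \<ge> 1" using \<open>d \<ge> 1\<close> \<open>n \<ge> 1\<close> by simp
  ultimately have one': "conv_one K G T (d * n) (blocks B) (blocks A)"
    using assms(2) T blocks_coeff_family[OF A] blocks_coeff_family[OF B]
    unfolding stably_finite_group_ring_iff[OF K.ring_axioms assms(1)] by blast
  define i' j' where "i' = i * n + u" and "j' = j * n + v"
  have bound: "k * n + w < d * n" if "k < d" "w < n" for k w
  proof -
    have "k * n + w < Suc k * n" using that by simp
    also have "\<dots> \<le> d * n" using that by (intro mult_le_mono1) simp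
    finally show ?thesis .
  qed
  have idx: "i' < d * n" "j' < d * n" "i' div n = i" "j' div n = j" "i' mod n = u" "j' mod n = v"
    using ij uv by (auto simp: i'_def j'_def bound)
  have "\<rho> (conv S G T d B A i j g) u v = conv K G T (d * n) (blocks B) (blocks A) i' j' g"
    by (simp only: conv_blocks[OF B A T(1) idx(1,2)] idx)
  also have "\<dots> = (if i' = j' \<and> g = \<one>\<^bsub>G\<^esub> then \<one>\<^bsub>K\<^esub> else \<zero>\<^bsub>K\<^esub>)"
    using one' idx g by (simp add: conv_one_def)
  also have "\<dots> = \<rho> (if i = j \<and> g = \<one>\<^bsub>G\<^esub> then \<one>\<^bsub>S\<^esub> else \<zero>\<^bsub>S\<^esub>) u v"
    using one_blocks[OF idx(1,2), of "g = \<one>\<^bsub>G\<^esub>"] idx by simp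
  finally show ?thesis .
qed

end

text \<open>
  The record of a subring and that of the whole ring have the same operations, but \<open>finsum\<close> also
  depends on the carrier.
\<close>

lemma finsum_subring:
  assumes "ring R" "subring S R" "f \<in> I \<rightarrow> S"
  shows "finsum (R\<lparr>carrier := S\<rparr>) f I = finsum R f I"
proof -
  interpret ring R by fact
  interpret S: ring "R\<lparr>carrier := S\<rparr>" by (rule subring_is_ring) fact
  note S = subringE[OF assms(2)]
  show ?thesis
    using assms(3)
  proof (induction I rule: infinite_finite_induct)
    case (insert i I)
    then have "f \<in> I \<rightarrow> carrier R" "f i \<in> carrier R" "f \<in> I \<rightarrow> S" "f i \<in> S"
      using S(1) by auto
    with insert show ?case by simp
  qed simp_all
qed

lemma conv_subring:
  assumes "ring R" "subring S R" "coeff_family (R\<lparr>carrier := S\<rparr>) T d A"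
    "coeff_family (R\<lparr>carrier := S\<rparr>) T d B" "i < d" "j < d"
  shows "conv (R\<lparr>carrier := S\<rparr>) G T d A B i j g = conv R G T d A B i j g"
proof -
  interpret ring R by fact
  interpret S: ring "R\<lparr>carrier := S\<rparr>" by (rule subring_is_ring) fact
  note S = subringE[OF assms(2)]
  have inner: "(\<lambda>(a, b). A i k a \<otimes>\<^bsub>R\<^esub> B k j b) \<in> {(a, b) \<in> T \<times> T. a \<otimes>\<^bsub>G\<^esub> b = g} \<rightarrow> S"
    if "k < d" for k
    using assms that S(6) by (auto simp: coeff_family_def)
  have sum_closed: "finsum R f I \<in> S" if "f \<in> I \<rightarrow> S" for I and f :: "'x \<Rightarrow> 'a"
    using S.finsum_closed[of f I] that finsum_subring[OF assms(1,2) that] by simp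
  have "conv (R\<lparr>carrier := S\<rparr>) G T d A B i j g = finsum (R\<lparr>carrier := S\<rparr>)
      (\<lambda>k. finsum R (\<lambda>(a, b). A i k a \<otimes>\<^bsub>R\<^esub> B k j b) {(a, b) \<in> T \<times> T. a \<otimes>\<^bsub>G\<^esub> b = g}) {..<d}"
    unfolding conv_def
    by (rule S.finsum_cong') (use finsum_subring[OF assms(1,2) inner] sum_closed[OF inner] in auto)
  also have "\<dots> = conv R G T d A B i j g"
    unfolding conv_def by (rule finsum_subring[OF assms(1,2)]) (use sum_closed[OF inner] in auto)
  finally show ?thesis .
qed

text \<open>
  The transfer criterion. In a counterexample over \<open>F\<close> some coefficient \<open>w\<close> of \<open>B A - 1\<close> is nonzero. The
  hypothesis is applied to all coefficients of \<open>A\<close> and \<open>B\<close> together with the inverse of \<open>w\<close>. Over \<open>K\<close> the image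
  of \<open>w\<close> is zero, although \<open>w\<close> is a unit of \<open>S\<close>. The field \<open>K\<close> may depend on the finite set \<open>E\<close>, which
  makes the criterion applicable to directed unions.
\<close>

lemma stably_finite_if_locally_represented:
  fixes F :: "('a, 'm) ring_scheme" and G :: "('g, 'x) monoid_scheme"
  assumes "field F" "monoid G"
    and local: "\<And>E. finite E \<Longrightarrow> E \<subseteq> carrier F \<Longrightarrow>
      \<exists>(K :: ('b, 'k) ring_scheme) S n \<rho>. E \<subseteq> S \<and> subring S F \<and> n \<ge> 1 \<and> field K \<and>
        stably_finite (group_ring K G) \<and> matrix_rep (F\<lparr>carrier := S\<rparr>) K n \<rho>"
  shows "stably_finite (group_ring F G)"
proof -
  interpret F: field F by fact
  have R: "ring F" by (rule F.ring_axioms)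
  show ?thesis
    unfolding stably_finite_group_ring_iff[OF R assms(2)]
  proof (intro allI impI, rule ccontr)
    fix d T A B
    assume d: "(d::nat) \<ge> 1" and T: "finite T" "T \<subseteq> carrier G"
      and A: "coeff_family F T d A" and B: "coeff_family F T d B"
      and one: "conv_one F G T d A B" and "\<not> conv_one F G T d B A"
    then obtain i j g where ij: "i < d" "j < d" and g: "g \<in> carrier G"
      and neq: "conv F G T d B A i j g \<noteq> (if i = j \<and> g = \<one>\<^bsub>G\<^esub> then \<one>\<^bsub>F\<^esub> else \<zero>\<^bsub>F\<^esub>)"
      by (auto simp: conv_one_def)
    define c where "c = conv F G T d B A i j g"
    define e where "e = (if i = j \<and> g = \<one>\<^bsub>G\<^esub> then \<one>\<^bsub>F\<^esub> else \<zero>\<^bsub>F\<^esub>)"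
    define w where "w = c \<ominus>\<^bsub>F\<^esub> e"
    have c: "c \<in> carrier F" unfolding c_def conv_def
      by (intro F.finsum_closed funcsetI) (use A B ij in \<open>auto simp: coeff_family_def\<close>)
    have e: "e \<in> carrier F" by (simp add: e_def)
    have "w \<noteq> \<zero>\<^bsub>F\<^esub>" using neq c e by (simp add: w_def c_def[symmetric] e_def[symmetric])
    moreover have w: "w \<in> carrier F" using c e by (simp add: w_def)
    ultimately have inv_w: "inv\<^bsub>F\<^esub> w \<in> carrier F" "w \<otimes>\<^bsub>F\<^esub> inv\<^bsub>F\<^esub> w = \<one>\<^bsub>F\<^esub>"
      by (simp_all add: F.field_Units)
    define E where "E = (\<Union>i<d. \<Union>j<d. A i j ` T \<union> B i j ` T) \<union> {inv\<^bsub>F\<^esub> w}"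
    have entries: "A i j a \<in> E" "B i j a \<in> E" if "i < d" "j < d" "a \<in> T" for i j a
      using that unfolding E_def by blast+
    have "finite E" "E \<subseteq> carrier F"
      using T A B inv_w by (auto simp: E_def coeff_family_def)
    from local[OF this] obtain K :: "('b, 'k) ring_scheme" and S n \<rho>
      where ES: "E \<subseteq> S" and S: "subring S F" and n: "n \<ge> 1" and K: "field K"
        and sf: "stably_finite (group_ring K G)" and rep: "matrix_rep (F\<lparr>carrier := S\<rparr>) K n \<rho>"
      by blast
    interpret K: field K by fact
    interpret M: matrix_representation "F\<lparr>carrier := S\<rparr>" K n \<rho>
      using F.subring_is_ring[OF S] rep
      by (simp add: matrix_representation_def matrix_representation_axioms_def K.ring_axioms)
    have AS: "coeff_family (F\<lparr>carrier := S\<rparr>) T d A" and BS: "coeff_family (F\<lparr>carrier := S\<rparr>) T d B"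
      using ES entries by (auto simp: coeff_family_def)
    have one': "conv_one (F\<lparr>carrier := S\<rparr>) G T d A B"
      using one by (simp add: conv_one_def conv_subring[OF R S AS BS])
    have cS: "c \<in> S"
      using M.conv_closed[OF BS AS ij, of G g] by (simp add: conv_subring[OF R S BS AS ij] c_def)
    have eS: "e \<in> S" using subringE(2,3)[OF S] by (simp add: e_def)
    have wS: "w \<in> S"
      using cS eS subringE(5,7)[OF S] by (simp add: w_def a_minus_def)
    have "\<rho> w u v = \<zero>\<^bsub>K\<^esub>" if uv: "u < n" "v < n" for u v
    proof -
      have "\<rho> c u v = \<rho> e u v"
        using M.rep_conv_commute[OF assms(2) sf n d T AS BS one' ij g uv]
        by (simp add: conv_subring[OF R S BS AS ij] c_def e_def)
      moreover have "w \<oplus>\<^bsub>F\<^esub> e = c" using c e unfolding w_def by algebra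
      ultimately have "\<rho> w u v \<oplus>\<^bsub>K\<^esub> \<rho> e u v = \<rho> e u v"
        using M.rep_add[of w e u v] wS eS uv by simp
      then show ?thesis
        using M.rep_closed[of w u v] M.rep_closed[of e u v] wS eS uv
        by (simp add: K.add.l_cancel_one)
    qed
    moreover have "inv\<^bsub>F\<^esub> w \<in> S" using ES by (simp add: E_def)
    ultimately show False
      using M.rep_unit_not_zero[OF n, of w "inv\<^bsub>F\<^esub> w"] K.one_not_zero wS inv_w(2) by simp
  qed
qed

section \<open>Homomorphisms and finite-dimensional algebras\<close>

lemma matrix_rep_comp:
  assumes "h \<in> Ring.ring_hom S S'" "matrix_rep S' K n \<rho>"
  shows "matrix_rep S K n (\<rho> \<circ> h)"
  using assms ring_hom_memE[OF assms(1)] by (simp add: matrix_rep_def)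

lemma matrix_rep_hom:
  assumes "h \<in> Ring.ring_hom S K" "ring K"
  shows "matrix_rep S K 1 (\<lambda>a i j. h a)"
proof -
  interpret K: ring K by fact
  have "finsum K (\<lambda>k. h a \<otimes>\<^bsub>K\<^esub> h b) {..<1::nat} = h a \<otimes>\<^bsub>K\<^esub> h b"
    if "a \<in> carrier S" "b \<in> carrier S" for a b
    using that ring_hom_memE(1)[OF assms(1)] by (simp add: lessThan_Suc)
  then show ?thesis
    using ring_hom_memE[OF assms(1)] by (simp add: matrix_rep_def)
qed

text \<open>
  A homomorphism into a field is a representation by matrices of size one, defined on
  all of \<open>F\<close>. Applied to inclusions this is the descent to subfields; applied to isomorphisms it is invariance.
\<close>

lemma stably_finite_via_hom:
  fixes F :: "('a, 'm) ring_scheme" and K :: "('b, 'n) ring_scheme"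
  assumes "field F" "field K" "monoid G" "h \<in> Ring.ring_hom F K" "stably_finite (group_ring K G)"
  shows "stably_finite (group_ring F G)"
proof (rule stably_finite_if_locally_represented[OF assms(1,3)])
  interpret F: field F by fact
  interpret K: field K by fact
  fix E assume "finite E" "E \<subseteq> carrier F"
  moreover have "matrix_rep (F\<lparr>carrier := carrier F\<rparr>) K 1 (\<lambda>a i j. h a)"
    using matrix_rep_hom[OF assms(4) K.ring_axioms] by simp
  ultimately show "\<exists>(K :: ('b, 'n) ring_scheme) S n \<rho>. E \<subseteq> S \<and> subring S F \<and> n \<ge> 1 \<and> field K \<and>
      stably_finite (group_ring K G) \<and> matrix_rep (F\<lparr>carrier := S\<rparr>) K n \<rho>"
    using F.carrier_is_subring assms(2,5)
    by (intro exI[of _ K] exI[of _ "carrier F"] exI[of _ "1::nat"] exI[of _ "\<lambda>a i j. h a"] conjI order_refl)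
qed

lemma stably_finite_image_subfield:
  assumes "ring_hom_ring R S h" "subfield K R" "\<one>\<^bsub>S\<^esub> \<noteq> \<zero>\<^bsub>S\<^esub>" "monoid G"
    and "stably_finite (group_ring (R\<lparr>carrier := K\<rparr>) G)"
  shows "subfield (h ` K) S" "stably_finite (group_ring (S\<lparr>carrier := h ` K\<rparr>) G)"
proof -
  interpret h: ring_hom_ring R S h by fact
  show img: "subfield (h ` K) S"
    by (rule h.img_is_subfield(2)) fact+
  have inj: "inj_on h K"
    by (rule h.img_is_subfield(1)) fact+
  interpret inv: ring_hom_ring "S\<lparr>carrier := h ` K\<rparr>" R "inv_into K h"
    using h.inv_ring_hom[OF inj subfieldE(1)[OF assms(2)]] .
  have "inv_into K h \<in> Ring.ring_hom (S\<lparr>carrier := h ` K\<rparr>) (R\<lparr>carrier := K\<rparr>)"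
  proof (rule ring_hom_memI)
    fix y assume "y \<in> carrier (S\<lparr>carrier := h ` K\<rparr>)"
    then show "inv_into K h y \<in> carrier (R\<lparr>carrier := K\<rparr>)" by (simp add: inv_into_into)
  qed (use inv.hom_mult inv.hom_add inv.hom_one in auto)
  then show "stably_finite (group_ring (S\<lparr>carrier := h ` K\<rparr>) G)"
    using stably_finite_via_hom h.S.subfield_iff(2)[OF img] h.R.subfield_iff(2)[OF assms(2)] assms(4,5)
    by blast
qed

text \<open>
  Linear combinations are defined by recursion on lists; interchanging the order of summation in a
  matrix product needs them as sums over an index set.
\<close>

lemma (in ring) combine_eq_finsum:
  assumes "length Ks = length Us" "set Ks \<subseteq> carrier R" "set Us \<subseteq> carrier R"
  shows "combine Ks Us = finsum R (\<lambda>i. Ks ! i \<otimes> Us ! i) {..<length Us}"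
  using assms
proof (induction Ks Us rule: list_induct2)
  case Nil
  then show ?case by simp
next
  case (Cons k Ks u Us)
  let ?f = "\<lambda>i. (k # Ks) ! i \<otimes> (u # Us) ! i"
  have f: "?f \<in> Suc ` {..<length Us} \<rightarrow> carrier R"
    using Cons.hyps Cons.prems by (auto simp: subset_iff)
  have "finsum R ?f {..<length (u # Us)} = finsum R ?f (insert 0 (Suc ` {..<length Us}))"
    by (simp add: lessThan_Suc_eq_insert_0)
  also have "\<dots> = k \<otimes> u \<oplus> finsum R ?f (Suc ` {..<length Us})"
    using f Cons.prems by (subst finsum_insert) auto
  also have "finsum R ?f (Suc ` {..<length Us}) = finsum R (\<lambda>i. ?f (Suc i)) {..<length Us}"
    by (rule finsum_reindex[OF f]) simp
  finally show ?case using Cons by simp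
qed

lemma (in ring) dimension_coordinates:
  assumes "subfield K R" "dimension n K E"
  shows "\<exists>v \<chi>. (\<forall>i<n. v i \<in> E) \<and> (\<forall>a\<in>E. (\<forall>i<n. \<chi> a i \<in> K) \<and>
    a = finsum R (\<lambda>i. \<chi> a i \<otimes> v i) {..<n} \<and>
    (\<forall>f. f \<in> {..<n} \<rightarrow> K \<longrightarrow> a = finsum R (\<lambda>i. f i \<otimes> v i) {..<n} \<longrightarrow> (\<forall>i<n. \<chi> a i = f i)))"
proof -
  obtain Vs where Vs: "set Vs \<subseteq> carrier R" "independent K Vs" "length Vs = n" "Span K Vs = E"
    using exists_base[OF assms] by blast
  have K: "K \<subseteq> carrier R" by (rule subfieldE(3)[OF assms(1)])
  define P where "P a Ks \<longleftrightarrow> set Ks \<subseteq> K \<and> length Ks = n \<and> a = combine Ks Vs" for a Ks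
  have unique: "\<exists>!Ks. P a Ks" if "a \<in> E" for a
    using unique_decomposition[OF assms(1) Vs(2)] that Vs(3,4) by (simp add: P_def)
  define c where "c a = (THE Ks. P a Ks)" for a
  have c: "P a (c a)" if "a \<in> E" for a
    unfolding c_def by (rule theI'[OF unique[OF that]])
  have combine: "combine Ks Vs = finsum R (\<lambda>i. Ks ! i \<otimes> Vs ! i) {..<n}"
    if "set Ks \<subseteq> K" "length Ks = n" for Ks
    using combine_eq_finsum[of Ks Vs] that K Vs by auto
  show ?thesis
  proof (intro exI[of _ "\<lambda>i. Vs ! i"] exI[of _ "\<lambda>a i. c a ! i"] conjI ballI allI impI)
    fix i assume "i < n"
    then show "Vs ! i \<in> E"
      using Span_base_incl[OF assms(1) Vs(1)] Vs by auto
  next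
    fix a i assume "a \<in> E" "i < n"
    then show "c a ! i \<in> K" using c[of a] by (auto simp: P_def subset_iff)
  next
    fix a assume "a \<in> E"
    then show "a = finsum R (\<lambda>i. c a ! i \<otimes> Vs ! i) {..<n}"
      using c[of a] combine[of "c a"] by (simp add: P_def)
  next
    fix a f i assume a: "a \<in> E" and f: "f \<in> {..<n} \<rightarrow> K"
      and sum: "a = finsum R (\<lambda>i. f i \<otimes> Vs ! i) {..<n}" and "i < n"
    have fK: "set (map f [0..<n]) \<subseteq> K" using f by auto
    have "combine (map f [0..<n]) Vs = finsum R (\<lambda>i. map f [0..<n] ! i \<otimes> Vs ! i) {..<n}"
      by (rule combine[OF fK]) simp
    also have "\<dots> = a"
      unfolding sum by (rule finsum_cong') (use f K Vs in \<open>auto simp: Pi_def subset_iff\<close>)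
    finally have "P a (map f [0..<n])" using fK by (simp add: P_def)
    then have "c a = map f [0..<n]" using unique[OF a] c[OF a] by blast
    then show "c a ! i = f i" using \<open>i < n\<close> by simp
  qed
qed

text \<open>
  The regular representation. Right multiplication by \<open>a\<close> is \<open>K\<close>-linear for the action of \<open>K\<close> from the left, and
  row \<open>i\<close> of the matrix of \<open>a\<close> holds the coordinates of \<open>v i \<otimes> a\<close>. With this convention the order of the
  factors is preserved, and uniqueness of coordinates gives every identity.
\<close>

lemma (in ring) dimension_imp_matrix_rep:
  assumes K: "subfield K R" and S: "subring S R" and dim: "dimension n K S"
  shows "\<exists>\<rho>. matrix_rep (R\<lparr>carrier := S\<rparr>) (R\<lparr>carrier := K\<rparr>) n \<rho>"
proof -
  obtain v \<chi> where v: "\<forall>i<n. v i \<in> S"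
    and coords: "\<forall>a\<in>S. (\<forall>i<n. \<chi> a i \<in> K) \<and> a = finsum R (\<lambda>i. \<chi> a i \<otimes> v i) {..<n} \<and>
      (\<forall>f. f \<in> {..<n} \<rightarrow> K \<longrightarrow> a = finsum R (\<lambda>i. f i \<otimes> v i) {..<n} \<longrightarrow> (\<forall>i<n. \<chi> a i = f i))"
    using dimension_coordinates[OF K dim] by (elim exE conjE)
  have \<chi>: "\<chi> a i \<in> K" if "a \<in> S" "i < n" for a i
    using coords that by blast
  have expand: "a = finsum R (\<lambda>i. \<chi> a i \<otimes> v i) {..<n}" if "a \<in> S" for a
    using coords that by blast
  have unique: "\<chi> a i = f i"
    if "a \<in> S" "f \<in> {..<n} \<rightarrow> K" "a = finsum R (\<lambda>i. f i \<otimes> v i) {..<n}" "i < n" for a f i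
    using coords that by blast
  note subK = subringE[OF subfieldE(1)[OF K]] and subS = subringE[OF S]
  interpret K: ring "R\<lparr>carrier := K\<rparr>" by (rule subring_is_ring[OF subfieldE(1)[OF K]])
  have KR: "k \<in> carrier R" if "k \<in> K" for k using that subK(1) by auto
  have SR: "a \<in> carrier R" if "a \<in> S" for a using that subS(1) by auto
  have sumK: "finsum R f I \<in> K" if "f \<in> I \<rightarrow> K" for f and I :: "nat set"
    using K.finsum_closed[of f I] finsum_subring[OF ring_axioms subfieldE(1)[OF K] that] that by simp
  define \<rho> where "\<rho> a i j = \<chi> (v i \<otimes> a) j" for a i j
  have va: "v i \<otimes> a \<in> S" if "i < n" "a \<in> S" for i a using that v subS(6) by auto
  have \<rho>K: "\<rho> a i j \<in> K" if "a \<in> S" "i < n" "j < n" for a i j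
    using that va \<chi> by (simp add: \<rho>_def)
  have \<rho>_expand: "v i \<otimes> a = finsum R (\<lambda>j. \<rho> a i j \<otimes> v j) {..<n}" if "a \<in> S" "i < n" for a i
    unfolding \<rho>_def by (rule expand[OF va]) fact+
  have add: "\<rho> (a \<oplus> b) i j = \<rho> a i j \<oplus> \<rho> b i j" if ab: "a \<in> S" "b \<in> S" and "i < n" "j < n" for a b i j
  proof -
    have "v i \<otimes> (a \<oplus> b) = v i \<otimes> a \<oplus> v i \<otimes> b"
      using that by (simp add: r_distr SR v)
    also have "\<dots> = finsum R (\<lambda>j. \<rho> a i j \<otimes> v j \<oplus> \<rho> b i j \<otimes> v j) {..<n}"
      unfolding \<rho>_expand[OF ab(1) \<open>i < n\<close>] \<rho>_expand[OF ab(2) \<open>i < n\<close>]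
      by (rule finsum_addf[symmetric]) (use that \<rho>K KR SR v in auto)
    also have "\<dots> = finsum R (\<lambda>j. (\<rho> a i j \<oplus> \<rho> b i j) \<otimes> v j) {..<n}"
      by (rule finsum_cong') (use that \<rho>K KR SR v in \<open>auto simp: l_distr\<close>)
    finally have *: "v i \<otimes> (a \<oplus> b) = finsum R (\<lambda>j. (\<rho> a i j \<oplus> \<rho> b i j) \<otimes> v j) {..<n}" .
    show ?thesis
      unfolding \<rho>_def[of "a \<oplus> b"]
      by (rule unique[OF va _ *]) (use that \<rho>K subK(7) subS(7) in auto)
  qed
  have mult: "\<rho> (a \<otimes> b) i j = finsum R (\<lambda>k. \<rho> a i k \<otimes> \<rho> b k j) {..<n}"
    if ab: "a \<in> S" "b \<in> S" and "i < n" "j < n" for a b i j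
  proof -
    have "v i \<otimes> (a \<otimes> b) = (v i \<otimes> a) \<otimes> b"
      using that by (simp add: m_assoc SR v)
    also have "\<dots> = finsum R (\<lambda>k. (\<rho> a i k \<otimes> v k) \<otimes> b) {..<n}"
      unfolding \<rho>_expand[OF ab(1) \<open>i < n\<close>]
      by (rule finsum_ldistr) (use that \<rho>K KR SR v in auto)
    also have "\<dots> = finsum R (\<lambda>k. finsum R (\<lambda>j. (\<rho> a i k \<otimes> \<rho> b k j) \<otimes> v j) {..<n}) {..<n}"
    proof (rule finsum_cong')
      fix k assume k: "k \<in> {..<n}"
      have "(\<rho> a i k \<otimes> v k) \<otimes> b = \<rho> a i k \<otimes> (v k \<otimes> b)"
        using that k by (simp add: m_assoc KR \<rho>K SR v)
      also have "\<dots> = finsum R (\<lambda>j. \<rho> a i k \<otimes> (\<rho> b k j \<otimes> v j)) {..<n}"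
        unfolding \<rho>_expand[OF ab(2) k[simplified]]
        by (rule finsum_rdistr) (use that k \<rho>K KR SR v in auto)
      also have "\<dots> = finsum R (\<lambda>j. (\<rho> a i k \<otimes> \<rho> b k j) \<otimes> v j) {..<n}"
        by (rule finsum_cong') (use that k \<rho>K KR SR v in \<open>auto simp: m_assoc\<close>)
      finally show "(\<rho> a i k \<otimes> v k) \<otimes> b = finsum R (\<lambda>j. (\<rho> a i k \<otimes> \<rho> b k j) \<otimes> v j) {..<n}" .
    qed (use that \<rho>K KR SR v in \<open>auto intro!: finsum_closed\<close>)
    also have "\<dots> = finsum R (\<lambda>j. finsum R (\<lambda>k. (\<rho> a i k \<otimes> \<rho> b k j) \<otimes> v j) {..<n}) {..<n}"
      by (rule finsum_swap) (use that \<rho>K KR SR v in auto)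
    also have "\<dots> = finsum R (\<lambda>j. finsum R (\<lambda>k. \<rho> a i k \<otimes> \<rho> b k j) {..<n} \<otimes> v j) {..<n}"
      by (rule finsum_cong')
        (use that \<rho>K KR SR v in \<open>auto intro!: finsum_ldistr[symmetric] finsum_closed\<close>)
    finally have *: "v i \<otimes> (a \<otimes> b) =
        finsum R (\<lambda>j. finsum R (\<lambda>k. \<rho> a i k \<otimes> \<rho> b k j) {..<n} \<otimes> v j) {..<n}" .
    show ?thesis
      unfolding \<rho>_def[of "a \<otimes> b"]
      by (rule unique[OF va _ *]) (use that \<rho>K subK(6) subS(6) in \<open>auto intro!: sumK\<close>)
  qed
  have one: "\<rho> \<one> i j = (if i = j then \<one> else \<zero>)" if "i < n" "j < n" for i j
  proof -
    have "v i \<otimes> \<one> = finsum R (\<lambda>j. if i = j then v j else \<zero>) {..<n}"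
      using that v SR by (subst finsum_singleton) auto
    also have "\<dots> = finsum R (\<lambda>j. (if i = j then \<one> else \<zero>) \<otimes> v j) {..<n}"
      by (rule finsum_cong') (use v SR in auto)
    finally have *: "v i \<otimes> \<one> = finsum R (\<lambda>j. (if i = j then \<one> else \<zero>) \<otimes> v j) {..<n}" .
    show ?thesis
      unfolding \<rho>_def by (rule unique[OF va _ *]) (use that subK(2,3) subS(3) in auto)
  qed
  have "finsum (R\<lparr>carrier := K\<rparr>) (\<lambda>k. \<rho> a i k \<otimes> \<rho> b k j) {..<n} = finsum R (\<lambda>k. \<rho> a i k \<otimes> \<rho> b k j) {..<n}"
    if "a \<in> S" "b \<in> S" "i < n" "j < n" for a b i j
    by (rule finsum_subring[OF ring_axioms subfieldE(1)[OF K]]) (use that \<rho>K subK(6) in auto)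
  then have "matrix_rep (R\<lparr>carrier := S\<rparr>) (R\<lparr>carrier := K\<rparr>) n \<rho>"
    by (simp add: matrix_rep_def \<rho>K add mult one)
  then show ?thesis by blast
qed

section \<open>Fractions and localisations inside a field\<close>

text \<open>
  The field of fractions of \<open>A\<close> inside \<open>F\<close>, described without division: an element belongs to it if some nonzero
  element of \<open>A\<close> is a denominator for it.
\<close>

definition fractions :: "('a, 'm) ring_scheme \<Rightarrow> 'a set \<Rightarrow> 'a set" where
  "fractions F A = {a \<in> carrier F. \<exists>u\<in>A - {\<zero>\<^bsub>F\<^esub>}. a \<otimes>\<^bsub>F\<^esub> u \<in> A}"

text \<open>
  The ring obtained from \<open>A\<close> by adjoining the inverse of \<open>u\<close>, again described by denominators. This is the
  intended meaning for nonzero \<open>u\<close>; for \<open>u = 0\<close> it is all of \<open>F\<close>.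
\<close>

definition localisation :: "('a, 'm) ring_scheme \<Rightarrow> 'a set \<Rightarrow> 'a \<Rightarrow> 'a set" where
  "localisation F A u = {a \<in> carrier F. \<exists>i::nat. a \<otimes>\<^bsub>F\<^esub> u [^]\<^bsub>F\<^esub> i \<in> A}"

context field
begin

lemma subset_fractions:
  assumes "subring A R"
  shows "A \<subseteq> fractions R A"
  using subringE(1,3)[OF assms] one_not_zero by (force simp: fractions_def)

lemma fractions_subfield:
  assumes "subring A R"
  shows "subfield (fractions R A) R"
proof -
  note A = subringE[OF assms]
  have AR: "a \<in> carrier R" if "a \<in> A" for a using that A(1) by auto
  show ?thesis
  proof (rule subfieldI')
    show "subring (fractions R A) R"
    proof (rule subringI)
      show "fractions R A \<subseteq> carrier R" by (auto simp: fractions_def)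
      show "\<one> \<in> fractions R A" using subset_fractions[OF assms] A(3) by auto
    next
      fix a assume "a \<in> fractions R A"
      then obtain u where u: "a \<in> carrier R" "u \<in> A - {\<zero>}" "a \<otimes> u \<in> A"
        by (auto simp: fractions_def)
      then have "\<ominus> a \<otimes> u \<in> A" using A(5)[of "a \<otimes> u"] AR by (simp add: l_minus)
      then show "\<ominus> a \<in> fractions R A" using u by (auto simp: fractions_def)
    next
      fix a b assume "a \<in> fractions R A" "b \<in> fractions R A"
      then obtain u w where u: "a \<in> carrier R" "u \<in> A - {\<zero>}" "a \<otimes> u \<in> A"
        and w: "b \<in> carrier R" "w \<in> A - {\<zero>}" "b \<otimes> w \<in> A"
        by (auto simp: fractions_def)
      have uw: "u \<in> carrier R" "w \<in> carrier R" "u \<otimes> w \<in> A - {\<zero>}"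
        using u w AR A(6) by (auto simp: integral_iff)
      have "(a \<otimes> b) \<otimes> (u \<otimes> w) = (a \<otimes> u) \<otimes> (b \<otimes> w)"
        "(a \<oplus> b) \<otimes> (u \<otimes> w) = (a \<otimes> u) \<otimes> w \<oplus> (b \<otimes> w) \<otimes> u"
        using u(1) w(1) uw(1,2) by algebra+
      then have "(a \<otimes> b) \<otimes> (u \<otimes> w) \<in> A" "(a \<oplus> b) \<otimes> (u \<otimes> w) \<in> A"
        using u w A(6,7) by auto
      then show "a \<otimes> b \<in> fractions R A" "a \<oplus> b \<in> fractions R A"
        using u w uw by (auto simp: fractions_def)
    qed
  next
    fix k assume "k \<in> fractions R A - {\<zero>}"
    then obtain u where u: "k \<in> carrier R" "k \<noteq> \<zero>" "u \<in> A" "u \<noteq> \<zero>" "k \<otimes> u \<in> A"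
      by (auto simp: fractions_def)
    have inv: "inv k \<in> carrier R" "inv k \<otimes> k = \<one>"
      using u by (simp_all add: field_Units)
    have "inv k \<otimes> (k \<otimes> u) = u"
      using inv u AR by (simp add: m_assoc[symmetric])
    moreover have "k \<otimes> u \<noteq> \<zero>" using u AR by (simp add: integral_iff)
    ultimately show "inv k \<in> fractions R A"
      using u inv by (auto simp: fractions_def intro!: bexI[of _ "k \<otimes> u"])
  qed
qed

text \<open>
  The product of denominators of the single elements is a denominator for all of them.
\<close>

lemma common_denominator:
  assumes "subring A R" "finite E" "E \<subseteq> fractions R A"
  shows "\<exists>u\<in>A - {\<zero>}. \<forall>e\<in>E. e \<otimes> u \<in> A"
  using assms(2,3)
proof (induction E rule: finite_induct)
  case empty
  show ?case using subringE(3)[OF assms(1)] by auto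
next
  case (insert e E)
  note A = subringE[OF assms(1)]
  obtain u where u: "u \<in> A - {\<zero>}" "\<forall>e\<in>E. e \<otimes> u \<in> A" using insert by auto
  obtain w where w: "e \<in> carrier R" "w \<in> A - {\<zero>}" "e \<otimes> w \<in> A"
    using insert by (auto simp: fractions_def)
  have uw: "u \<in> carrier R" "w \<in> carrier R" "u \<otimes> w \<in> A - {\<zero>}"
    using u w A(1,6) by (auto simp: integral_iff subset_iff)
  have "e' \<otimes> (u \<otimes> w) \<in> A" if "e' \<in> E" for e'
  proof -
    have "e' \<in> carrier R" using that insert.prems by (auto simp: fractions_def)
    then have "e' \<otimes> (u \<otimes> w) = (e' \<otimes> u) \<otimes> w" using uw by (simp add: m_assoc)
    then show ?thesis using u w that A(6) by auto
  qed
  moreover have "e \<otimes> (u \<otimes> w) \<in> A"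
  proof -
    have "e \<otimes> (u \<otimes> w) = (e \<otimes> w) \<otimes> u" using uw w(1) by algebra
    then show ?thesis using u w A(6) by auto
  qed
  ultimately show ?case using uw(3) by auto
qed

lemma nat_pow_in_subring:
  assumes "subring A R" "u \<in> A"
  shows "u [^] (i::nat) \<in> A"
  using subringE(3,6)[OF assms(1)] assms(2) by (induction i) auto

lemma localisation_common_exponent:
  assumes A: "subring A R" and u: "u \<in> A" and a: "a \<in> localisation R A u" and b: "b \<in> localisation R A u"
  obtains i :: nat where "a \<otimes> u [^] i \<in> A" "b \<otimes> u [^] i \<in> A"
proof -
  obtain i j :: nat where ij: "a \<in> carrier R" "a \<otimes> u [^] i \<in> A" "b \<in> carrier R" "b \<otimes> u [^] j \<in> A"
    using a b by (auto simp: localisation_def)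
  have uR: "u \<in> carrier R" using u subringE(1)[OF A] by auto
  have "a \<otimes> u [^] (i + j) = (a \<otimes> u [^] i) \<otimes> u [^] j" "b \<otimes> u [^] (i + j) = (b \<otimes> u [^] j) \<otimes> u [^] i"
    using ij(1,3) nat_pow_closed[OF uR, of i] nat_pow_closed[OF uR, of j]
    unfolding nat_pow_mult[OF uR, symmetric] by algebra+
  then have "a \<otimes> u [^] (i + j) \<in> A" "b \<otimes> u [^] (i + j) \<in> A"
    using subringE(6)[OF A] ij nat_pow_in_subring[OF A u] by auto
  then show thesis by (rule that)
qed

lemma localisation_arith:
  assumes "a \<in> carrier R" "b \<in> carrier R" "u \<in> carrier R"
  shows "(a \<oplus> b) \<otimes> u [^] (i::nat) = a \<otimes> u [^] i \<oplus> b \<otimes> u [^] i"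
    and "(a \<otimes> b) \<otimes> u [^] (i + i) = (a \<otimes> u [^] i) \<otimes> (b \<otimes> u [^] i)"
    and "(\<ominus> a) \<otimes> u [^] i = \<ominus> (a \<otimes> u [^] i)"
proof -
  have ui: "u [^] i \<in> carrier R" using assms by simp
  show "(a \<oplus> b) \<otimes> u [^] i = a \<otimes> u [^] i \<oplus> b \<otimes> u [^] i" "(\<ominus> a) \<otimes> u [^] i = \<ominus> (a \<otimes> u [^] i)"
    using assms ui by (simp_all add: l_distr l_minus)
  have "(a \<otimes> b) \<otimes> (u [^] i \<otimes> u [^] i) = (a \<otimes> u [^] i) \<otimes> (b \<otimes> u [^] i)"
    using assms ui by algebra
  then show "(a \<otimes> b) \<otimes> u [^] (i + i) = (a \<otimes> u [^] i) \<otimes> (b \<otimes> u [^] i)"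
    using assms by (simp add: nat_pow_mult[symmetric])
qed

lemma localisation_subring:
  assumes A: "subring A R" and u: "u \<in> A"
  shows "subring (localisation R A u) R"
proof -
  note subA = subringE[OF A]
  have uR: "u \<in> carrier R" using u subA(1) by auto
  have loc: "a \<in> localisation R A u" if "a \<in> carrier R" "a \<otimes> u [^] (i::nat) \<in> A" for a i
    using that by (auto simp: localisation_def)
  show ?thesis
  proof (rule subringI)
    show L: "localisation R A u \<subseteq> carrier R" by (auto simp: localisation_def)
    show "\<one> \<in> localisation R A u" by (rule loc[of _ 0]) (use subA(3) in auto)
    fix a b assume ab: "a \<in> localisation R A u" "b \<in> localisation R A u"
    then have abR: "a \<in> carrier R" "b \<in> carrier R" using L by auto
    obtain i :: nat where i: "a \<otimes> u [^] i \<in> A" "b \<otimes> u [^] i \<in> A"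
      using localisation_common_exponent[OF A u ab] .
    note arith = localisation_arith[OF abR uR, of i]
    show "\<ominus> a \<in> localisation R A u" by (rule loc[of _ i]) (use arith abR i subA(5) in auto)
    show "a \<oplus> b \<in> localisation R A u" by (rule loc[of _ i]) (use arith abR i subA(7) in auto)
    show "a \<otimes> b \<in> localisation R A u" by (rule loc[of _ "i + i"]) (use arith abR i subA(6) in auto)
  qed
qed

text \<open>
  Universal property of localisation: the fraction \<open>b / u^i\<close> with \<open>b \<in> A\<close> is sent to \<open>h b \<otimes> v^i\<close>, where \<open>v\<close> is the
  inverse of \<open>h u\<close>. Enlarging the exponent multiplies this value by a power of \<open>h u \<otimes> v = 1\<close>, so the choice
  of the exponent is immaterial.
\<close>

lemma extend_hom_to_localisation:
  assumes A: "subring A R" and u: "u \<in> A" and B: "cring B"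
    and h: "h \<in> Ring.ring_hom (R\<lparr>carrier := A\<rparr>) B"
    and v: "v \<in> carrier B" "h u \<otimes>\<^bsub>B\<^esub> v = \<one>\<^bsub>B\<^esub>"
  shows "\<exists>h'. h' \<in> Ring.ring_hom (R\<lparr>carrier := localisation R A u\<rparr>) B"
proof -
  interpret B: cring B by fact
  note subA = subringE[OF A]
  have uR: "u \<in> carrier R" using u subA(1) by auto
  have hB: "h a \<in> carrier B" if "a \<in> A" for a using ring_hom_closed[OF h] that by simp
  have hmult: "h (a \<otimes> b) = h a \<otimes>\<^bsub>B\<^esub> h b" if "a \<in> A" "b \<in> A" for a b
    using ring_hom_mult[OF h] that by simp
  have hadd: "h (a \<oplus> b) = h a \<oplus>\<^bsub>B\<^esub> h b" if "a \<in> A" "b \<in> A" for a b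
    using ring_hom_add[OF h] that by simp
  have uA: "u [^] i \<in> A" for i :: nat by (rule nat_pow_in_subring[OF A u])
  have hpow: "h (u [^] i) \<otimes>\<^bsub>B\<^esub> v [^]\<^bsub>B\<^esub> i = \<one>\<^bsub>B\<^esub>" for i :: nat
  proof (induction i)
    case 0
    then show ?case using ring_hom_one[OF h] by simp
  next
    case (Suc i)
    have "h (u [^] Suc i) \<otimes>\<^bsub>B\<^esub> v [^]\<^bsub>B\<^esub> Suc i =
        (h (u [^] i) \<otimes>\<^bsub>B\<^esub> h u) \<otimes>\<^bsub>B\<^esub> (v [^]\<^bsub>B\<^esub> i \<otimes>\<^bsub>B\<^esub> v)"
      using hmult[OF uA[of i] u] by simp
    also have "\<dots> = (h (u [^] i) \<otimes>\<^bsub>B\<^esub> v [^]\<^bsub>B\<^esub> i) \<otimes>\<^bsub>B\<^esub> (h u \<otimes>\<^bsub>B\<^esub> v)"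
      using hB[OF uA[of i]] hB[OF u] v(1) B.nat_pow_closed[OF v(1), of i] by algebra
    finally show ?case using Suc v by simp
  qed
  \<comment> \<open>An arbitrary admissible exponent; the value of \<open>h'\<close> does not depend on it.\<close>
  define N where "N a = (SOME i::nat. a \<otimes> u [^] i \<in> A)" for a
  define h' where "h' a = h (a \<otimes> u [^] N a) \<otimes>\<^bsub>B\<^esub> v [^]\<^bsub>B\<^esub> N a" for a
  have shift: "h (a \<otimes> u [^] (i + k)) \<otimes>\<^bsub>B\<^esub> v [^]\<^bsub>B\<^esub> (i + k) = h (a \<otimes> u [^] i) \<otimes>\<^bsub>B\<^esub> v [^]\<^bsub>B\<^esub> i"
    if "a \<in> carrier R" "a \<otimes> u [^] i \<in> A" for a and i k :: nat
  proof -
    have "a \<otimes> u [^] (i + k) = (a \<otimes> u [^] i) \<otimes> u [^] k"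
      using that uR by (simp add: nat_pow_mult[symmetric] m_assoc)
    then have "h (a \<otimes> u [^] (i + k)) \<otimes>\<^bsub>B\<^esub> v [^]\<^bsub>B\<^esub> (i + k) =
        (h (a \<otimes> u [^] i) \<otimes>\<^bsub>B\<^esub> h (u [^] k)) \<otimes>\<^bsub>B\<^esub> (v [^]\<^bsub>B\<^esub> i \<otimes>\<^bsub>B\<^esub> v [^]\<^bsub>B\<^esub> k)"
      using hmult[OF that(2) uA[of k]] v(1) by (simp add: B.nat_pow_mult)
    also have "\<dots> = (h (a \<otimes> u [^] i) \<otimes>\<^bsub>B\<^esub> v [^]\<^bsub>B\<^esub> i) \<otimes>\<^bsub>B\<^esub> (h (u [^] k) \<otimes>\<^bsub>B\<^esub> v [^]\<^bsub>B\<^esub> k)"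
      using hB[OF uA[of k]] hB[OF that(2)] B.nat_pow_closed[OF v(1), of i]
        B.nat_pow_closed[OF v(1), of k] by algebra
    finally show ?thesis using hpow[of k] hB[OF that(2)] v(1) by simp
  qed
  have h': "h' a = h (a \<otimes> u [^] i) \<otimes>\<^bsub>B\<^esub> v [^]\<^bsub>B\<^esub> i"
    if "a \<in> carrier R" "a \<otimes> u [^] i \<in> A" for a and i :: nat
  proof -
    have "a \<otimes> u [^] N a \<in> A" unfolding N_def by (rule someI) (rule that(2))
    then show ?thesis
      using shift[OF that, of "N a"] shift[OF that(1), of "N a" i] by (simp add: h'_def add.commute)
  qed
  have "h' \<in> Ring.ring_hom (R\<lparr>carrier := localisation R A u\<rparr>) B"
  proof (rule ring_hom_memI)
    fix a assume "a \<in> carrier (R\<lparr>carrier := localisation R A u\<rparr>)"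
    then obtain i :: nat where "a \<in> carrier R" "a \<otimes> u [^] i \<in> A" by (auto simp: localisation_def)
    then show "h' a \<in> carrier B" using h' hB v(1) by simp
  next
    fix a b assume "a \<in> carrier (R\<lparr>carrier := localisation R A u\<rparr>)"
      "b \<in> carrier (R\<lparr>carrier := localisation R A u\<rparr>)"
    then have ab: "a \<in> localisation R A u" "b \<in> localisation R A u" by simp_all
    then have abR: "a \<in> carrier R" "b \<in> carrier R" by (auto simp: localisation_def)
    obtain i :: nat where i: "a \<otimes> u [^] i \<in> A" "b \<otimes> u [^] i \<in> A"
      using localisation_common_exponent[OF A u ab] .
    note arith = localisation_arith[OF abR uR, of i]
    note B_closed = hB[OF i(1)] hB[OF i(2)] B.nat_pow_closed[OF v(1), of i]
    have "h' (a \<oplus> b) = h (a \<otimes> u [^] i \<oplus> b \<otimes> u [^] i) \<otimes>\<^bsub>B\<^esub> v [^]\<^bsub>B\<^esub> i"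
      using h'[of "a \<oplus> b" i] abR i subA(7) by (simp add: arith(1))
    then show "h' (a \<oplus>\<^bsub>R\<lparr>carrier := localisation R A u\<rparr>\<^esub> b) = h' a \<oplus>\<^bsub>B\<^esub> h' b"
      using h'[OF abR(1) i(1)] h'[OF abR(2) i(2)] B_closed by (simp add: hadd[OF i] B.l_distr)
    have "h' (a \<otimes> b) = h ((a \<otimes> u [^] i) \<otimes> (b \<otimes> u [^] i)) \<otimes>\<^bsub>B\<^esub> v [^]\<^bsub>B\<^esub> (i + i)"
      using h'[of "a \<otimes> b" "i + i"] abR i subA(6) by (simp add: arith(2))
    also have "\<dots> = (h (a \<otimes> u [^] i) \<otimes>\<^bsub>B\<^esub> h (b \<otimes> u [^] i)) \<otimes>\<^bsub>B\<^esub> (v [^]\<^bsub>B\<^esub> i \<otimes>\<^bsub>B\<^esub> v [^]\<^bsub>B\<^esub> i)"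
      using v(1) by (simp add: hmult[OF i] B.nat_pow_mult)
    also have "\<dots> = (h (a \<otimes> u [^] i) \<otimes>\<^bsub>B\<^esub> v [^]\<^bsub>B\<^esub> i) \<otimes>\<^bsub>B\<^esub> (h (b \<otimes> u [^] i) \<otimes>\<^bsub>B\<^esub> v [^]\<^bsub>B\<^esub> i)"
      using B_closed by algebra
    finally show "h' (a \<otimes>\<^bsub>R\<lparr>carrier := localisation R A u\<rparr>\<^esub> b) = h' a \<otimes>\<^bsub>B\<^esub> h' b"
      using h'[OF abR(1) i(1)] h'[OF abR(2) i(2)] by simp
  next
    show "h' \<one>\<^bsub>R\<lparr>carrier := localisation R A u\<rparr>\<^esub> = \<one>\<^bsub>B\<^esub>"
      using h'[of \<one> 0] subA(3) ring_hom_one[OF h] by simp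
  qed
  then show ?thesis by (intro exI)
qed

end

section \<open>Adjoining one element to a field\<close>

text \<open>
  For algebraic \<open>x\<close> the ring \<open>K[x]\<close> is a field of finite degree over \<open>K\<close>, and its regular representation is defined on
  the whole of it.
\<close>

lemma (in field) stably_finite_algebraic_extension:
  assumes "subfield K R" "x \<in> carrier R" "(algebraic over K) x" "monoid G"
    and sf: "stably_finite (group_ring (R\<lparr>carrier := K\<rparr>) G)"
  shows "stably_finite (group_ring (R\<lparr>carrier := simple_extension K x\<rparr>) G)"
proof -
  define A where "A = simple_extension K x"
  have A: "subfield A R"
    unfolding A_def using simple_extension_is_subfield assms(1-3) by blast
  have fields: "field (R\<lparr>carrier := K\<rparr>)" "field (R\<lparr>carrier := A\<rparr>)"
    using subfield_iff(2) assms(1) A by blast+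
  interpret A: field "R\<lparr>carrier := A\<rparr>" by (rule fields(2))
  have dim: "dimension (degree (Irr K x)) K A"
    unfolding A_def by (rule dimension_simple_extension) fact+
  have n: "degree (Irr K x) \<ge> 1"
    using pirreducible_degree[OF assms(1)] IrrE(1,2)[OF assms(1-3)] by blast
  obtain \<rho> where \<rho>: "matrix_rep (R\<lparr>carrier := A\<rparr>) (R\<lparr>carrier := K\<rparr>) (degree (Irr K x)) \<rho>"
    using dimension_imp_matrix_rep[OF assms(1) subfieldE(1)[OF A] dim] by blast
  show ?thesis
    unfolding A_def[symmetric]
  proof (rule stably_finite_if_locally_represented[OF fields(2) assms(4)])
    fix E assume "finite E" "E \<subseteq> carrier (R\<lparr>carrier := A\<rparr>)"
    then show "\<exists>(K' :: ('a, 'b) ring_scheme) S n \<rho>. E \<subseteq> S \<and> subring S (R\<lparr>carrier := A\<rparr>) \<and> n \<ge> 1 \<and> field K' \<and>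
        stably_finite (group_ring K' G) \<and> matrix_rep (R\<lparr>carrier := A, carrier := S\<rparr>) K' n \<rho>"
      using fields(1) sf n \<rho> A.carrier_is_subring
      by (intro exI[of _ "R\<lparr>carrier := K\<rparr>"] exI[of _ A] exI[of _ "degree (Irr K x)"] exI[of _ \<rho>]) simp
  qed
qed

text \<open>
  The substitute for the Nullstellensatz. Since \<open>x\<close> is transcendental, there is an isomorphism from \<open>K[x]\<close> to
  the polynomial ring, and it sends \<open>u\<close> to a nonzero polynomial \<open>f\<close>. The polynomial \<open>1 + X f\<close> has positive degree and is coprime to \<open>f\<close>, so
  the quotient by it is a nonzero finite-dimensional algebra in which \<open>f\<close> is invertible. It is in general
  neither a field nor a domain, and its ground field is the image of \<open>K\<close> in it, which explains the type of
  \<open>K'\<close>.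
\<close>

lemma (in field) localisation_rep_transcendental:
  assumes K: "subfield K R" and x: "x \<in> carrier R" and trans: "(transcendental over K) x"
    and G: "monoid G" and sf: "stably_finite (group_ring (R\<lparr>carrier := K\<rparr>) G)"
    and u: "u \<in> simple_extension K x - {\<zero>}"
  shows "\<exists>(K' :: 'a list set ring) n \<rho>. n \<ge> 1 \<and> field K' \<and> stably_finite (group_ring K' G) \<and>
    matrix_rep (R\<lparr>carrier := localisation R (simple_extension K x) u\<rparr>) K' n \<rho>"
proof -
  define A where "A = simple_extension K x"
  note subringK = subfieldE(1)[OF K]
  have A: "subring A R"
    unfolding A_def by (rule simple_extension_is_subring[OF subringK x])
  interpret A: ring "R\<lparr>carrier := A\<rparr>" by (rule subring_is_ring[OF A])
  interpret UP: domain "K[X]" by (rule univ_poly_is_domain[OF subringK])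
  have uA: "u \<in> A" "u \<noteq> \<zero>" using u by (auto simp: A_def)
  obtain \<phi> where \<phi>: "\<phi> \<in> ring_iso (R\<lparr>carrier := A\<rparr>) (K[X])"
    using ring_iso_sym[OF univ_poly_is_ring[OF subringK] simple_extension_of_transcendental[OF subringK x trans]]
    unfolding is_ring_iso_def A_def by blast
  have \<phi>_hom: "\<phi> \<in> Ring.ring_hom (R\<lparr>carrier := A\<rparr>) (K[X])" and \<phi>_inj: "inj_on \<phi> A"
    using \<phi> by (auto simp: ring_iso_def bij_betw_def)
  interpret \<phi>: ring_hom_ring "R\<lparr>carrier := A\<rparr>" "K[X]" \<phi>
    by (rule ring_hom_ringI2[OF A.ring_axioms UP.ring_axioms \<phi>_hom])
  define f where "f = \<phi> u"
  have f: "f \<in> carrier (K[X])" using \<phi>.hom_closed uA by (simp add: f_def)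
  have f_nz: "f \<noteq> []"
  proof
    assume "f = []"
    then have "\<phi> u = \<phi> \<zero>" using \<phi>.hom_zero by (simp add: f_def univ_poly_zero)
    then show False using \<phi>_inj uA subringE(2)[OF A] by (auto dest: inj_onD)
  qed
  have var: "X \<in> carrier (K[X])" by (rule var_closed(1)[OF subringK])
  \<comment> \<open>Modulo this polynomial \<open>f\<close> is a unit with inverse \<open>- X\<close>.\<close>
  define q where "q = \<one>\<^bsub>K[X]\<^esub> \<oplus>\<^bsub>K[X]\<^esub> X \<otimes>\<^bsub>K[X]\<^esub> f"
  have Xf: "X \<otimes>\<^bsub>K[X]\<^esub> f \<in> carrier (K[X])" using var f by simp
  have q: "q \<in> carrier (K[X])" using Xf by (simp add: q_def)
  have "degree (X \<otimes>\<^bsub>K[X]\<^esub> f) = degree X + degree f"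
    unfolding univ_poly_mult
      poly_mult_degree_eq[OF subringK var[folded univ_poly_carrier] f[folded univ_poly_carrier]]
    using f_nz by (simp add: var_def)
  moreover have "degree X = 1" by (simp add: var_def)
  ultimately have len: "length (X \<otimes>\<^bsub>K[X]\<^esub> f) \<ge> 2" by linarith
  have "length q = max (length \<one>\<^bsub>K[X]\<^esub>) (length (X \<otimes>\<^bsub>K[X]\<^esub> f))"
    unfolding q_def univ_poly_add
    by (rule poly_add_length_eq[OF subringK])
      (use len Xf UP.one_closed in \<open>simp_all add: univ_poly_carrier univ_poly_one\<close>)
  then have deg: "degree q > 0" using len by simp
  define B where "B = Rupt K q"
  interpret \<pi>: ring_hom_ring "K[X]" B "rupture_surj K q"
    unfolding B_def by (rule rupture_surj_hom(2)[OF subringK q])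
  have B: "cring B"
    unfolding B_def rupture_def
    by (rule ideal.quotient_is_cring[OF UP.cgenideal_ideal[OF q] UP.is_cring])
  have "rupture_surj K q q = \<zero>\<^bsub>B\<^esub>"
    unfolding B_def rupture_def FactRing_def ring_record_simps
    by (rule UP.a_rcos_zero[OF UP.cgenideal_ideal[OF q] UP.cgenideal_self[OF q]])
  moreover have "f \<otimes>\<^bsub>K[X]\<^esub> (\<ominus>\<^bsub>K[X]\<^esub> X) = \<one>\<^bsub>K[X]\<^esub> \<oplus>\<^bsub>K[X]\<^esub> (\<ominus>\<^bsub>K[X]\<^esub> q)"
    unfolding q_def using f var by algebra
  ultimately have unit: "rupture_surj K q f \<otimes>\<^bsub>B\<^esub> rupture_surj K q (\<ominus>\<^bsub>K[X]\<^esub> X) = \<one>\<^bsub>B\<^esub>"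
    using \<pi>.hom_mult[of f "\<ominus>\<^bsub>K[X]\<^esub> X"] f var q by simp
  have "\<exists>h. h \<in> Ring.ring_hom (R\<lparr>carrier := localisation R A u\<rparr>) B"
  proof (rule extend_hom_to_localisation[OF A uA(1) B])
    show "rupture_surj K q \<circ> \<phi> \<in> Ring.ring_hom (R\<lparr>carrier := A\<rparr>) B"
      by (rule ring_hom_trans[OF \<phi>_hom \<pi>.homh])
    show "rupture_surj K q (\<ominus>\<^bsub>K[X]\<^esub> X) \<in> carrier B"
      using var by simp
    show "(rupture_surj K q \<circ> \<phi>) u \<otimes>\<^bsub>B\<^esub> rupture_surj K q (\<ominus>\<^bsub>K[X]\<^esub> X) = \<one>\<^bsub>B\<^esub>"
      using unit by (simp add: f_def)
  qed
  then obtain h where h: "h \<in> Ring.ring_hom (R\<lparr>carrier := localisation R A u\<rparr>) B" by blast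
  define K' where "K' = rupture_surj K q ` poly_of_const ` K"
  have K'_eq: "K' = (rupture_surj K q \<circ> poly_of_const) ` K" by (simp add: K'_def image_comp)
  have dim: "ring.dimension B (degree q) K' (carrier B)"
    unfolding B_def K'_def by (rule rupture_dimension[OF K q deg])
  have field_K: "field (R\<lparr>carrier := K\<rparr>)" by (rule subfield_iff(2)[OF K])
  have hom_K: "ring_hom_ring (R\<lparr>carrier := K\<rparr>) B (rupture_surj K q \<circ> poly_of_const)"
    using ring_hom_ringI2[OF subring_is_ring[OF subringK] \<pi>.S.ring_axioms]
      rupture_surj_norm_is_hom[OF subringK q] by (simp add: B_def)
  have K_in_K: "subfield K (R\<lparr>carrier := K\<rparr>)"
    using field.carrier_is_subfield[OF field_K] by simp
  have one_B: "\<one>\<^bsub>B\<^esub> \<noteq> \<zero>\<^bsub>B\<^esub>"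
    unfolding B_def by (rule rupture_one_not_zero[OF K q deg])
  have "stably_finite (group_ring (R\<lparr>carrier := K, carrier := K\<rparr>) G)"
    using sf by simp
  note K' = stably_finite_image_subfield[OF hom_K K_in_K one_B G this, folded K'_eq]
  obtain \<rho> where "matrix_rep (B\<lparr>carrier := carrier B\<rparr>) (B\<lparr>carrier := K'\<rparr>) (degree q) \<rho>"
    using \<pi>.S.dimension_imp_matrix_rep[OF K'(1) \<pi>.S.carrier_is_subring dim] by blast
  then have "matrix_rep (R\<lparr>carrier := localisation R A u\<rparr>) (B\<lparr>carrier := K'\<rparr>) (degree q) (\<rho> \<circ> h)"
    by (intro matrix_rep_comp[OF h]) simp
  moreover have "field (B\<lparr>carrier := K'\<rparr>)" by (rule \<pi>.S.subfield_iff(2)[OF K'(1)])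
  moreover have "degree q \<ge> 1" using deg by simp
  ultimately show ?thesis
    unfolding A_def[symmetric] using K'(2) by (intro exI conjI)
qed

text \<open>
  No single representation covers the field \<open>K(x)\<close>, but a finite subset of it has a common
  denominator \<open>u\<close> and lies in the localisation at \<open>u\<close>, which is represented.
\<close>

lemma (in field) stably_finite_transcendental_extension:
  assumes K: "subfield K R" and x: "x \<in> carrier R" and trans: "(transcendental over K) x"
    and G: "monoid G" and sf: "stably_finite (group_ring (R\<lparr>carrier := K\<rparr>) G)"
  shows "stably_finite (group_ring (R\<lparr>carrier := fractions R (simple_extension K x)\<rparr>) G)"
proof -
  define A where "A = simple_extension K x"
  define L where "L = fractions R A"
  have A: "subring A R"
    unfolding A_def by (rule simple_extension_is_subring[OF subfieldE(1)[OF K] x])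
  have field_L: "field (R\<lparr>carrier := L\<rparr>)"
    unfolding L_def by (rule subfield_iff(2)[OF fractions_subfield[OF A]])
  interpret L: field "R\<lparr>carrier := L\<rparr>" by (rule field_L)
  show ?thesis
    unfolding A_def[symmetric] L_def[symmetric]
  proof (rule stably_finite_if_locally_represented[OF field_L G])
    fix E assume E: "finite E" "E \<subseteq> carrier (R\<lparr>carrier := L\<rparr>)"
    then obtain u where u: "u \<in> A - {\<zero>}" "\<forall>e\<in>E. e \<otimes> u \<in> A"
      using common_denominator[OF A, of E] by (auto simp: L_def)
    define S where "S = localisation R A u"
    have uR: "u \<in> carrier R" using u(1) subringE(1)[OF A] by auto
    have S: "subring S R" unfolding S_def by (rule localisation_subring[OF A]) (use u in auto)
    have ES: "E \<subseteq> S"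
    proof
      fix e assume "e \<in> E"
      then have "e \<in> carrier R" "e \<otimes> u [^] (1::nat) \<in> A"
        using E u uR by (auto simp: L_def fractions_def)
      then show "e \<in> S" unfolding S_def localisation_def by blast
    qed
    have SL: "S \<subseteq> L"
    proof
      fix a assume "a \<in> S"
      then obtain i :: nat where "a \<in> carrier R" "a \<otimes> u [^] i \<in> A"
        by (auto simp: S_def localisation_def)
      moreover have "u [^] i \<in> A - {\<zero>}"
      proof -
        have "u [^] i \<noteq> \<zero>"
          using u(1) uR by (induction i) (auto simp: integral_iff)
        then show ?thesis using nat_pow_in_subring[OF A] u(1) by auto
      qed
      ultimately show "a \<in> L" by (auto simp: L_def fractions_def)
    qed
    have "subring S (R\<lparr>carrier := L\<rparr>)"
      by (rule L.ring_incl_imp_subring) (use SL subring_is_ring[OF S] in simp_all)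
    moreover obtain K' :: "'a list set ring" and n \<rho> where "n \<ge> 1" "field K'" "stably_finite (group_ring K' G)"
      "matrix_rep (R\<lparr>carrier := S\<rparr>) K' n \<rho>"
      using localisation_rep_transcendental[OF K x trans G sf u(1)[unfolded A_def]]
      unfolding S_def A_def by blast
    ultimately show "\<exists>(K' :: 'a list set ring) S n \<rho>. E \<subseteq> S \<and> subring S (R\<lparr>carrier := L\<rparr>) \<and> n \<ge> 1 \<and>
        field K' \<and> stably_finite (group_ring K' G) \<and> matrix_rep (R\<lparr>carrier := L, carrier := S\<rparr>) K' n \<rho>"
      using ES by (intro exI[of _ K'] exI[of _ S] exI[of _ n] exI[of _ \<rho>]) simp
  qed
qed

lemma (in field) stably_finite_adjoin:
  assumes K: "subfield K R" and x: "x \<in> carrier R" and G: "monoid G"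
    and sf: "stably_finite (group_ring (R\<lparr>carrier := K\<rparr>) G)"
  shows "\<exists>L. subfield L R \<and> K \<subseteq> L \<and> x \<in> L \<and> stably_finite (group_ring (R\<lparr>carrier := L\<rparr>) G)"
proof -
  define A where "A = simple_extension K x"
  have A: "subring A R" "K \<subseteq> A" "x \<in> A"
    unfolding A_def
    using simple_extension_is_subring simple_extension_incl simple_extension_mem
      subfieldE(1,3)[OF K] x by blast+
  show ?thesis
  proof (cases "(algebraic over K) x")
    case True
    then have "subfield A R" "stably_finite (group_ring (R\<lparr>carrier := A\<rparr>) G)"
      unfolding A_def using simple_extension_is_subfield[OF K x]
        stably_finite_algebraic_extension[OF K x _ G sf] by auto
    with A show ?thesis by blast
  next
    case False
    then have "(transcendental over K) x" by (simp add: over_def)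
    then have "stably_finite (group_ring (R\<lparr>carrier := fractions R A\<rparr>) G)"
      unfolding A_def by (rule stably_finite_transcendental_extension[OF K x _ G sf])
    with A show ?thesis
      using fractions_subfield[OF A(1)] subset_fractions[OF A(1)] by blast
  qed
qed

text \<open>
  Adjoining the elements of a finite set one by one shows that \<open>R\<close> is the directed union of subfields with stably
  finite group ring; for the criterion each of them is represented over itself by the identity.
\<close>

lemma (in field) stably_finite_ascend:
  assumes P: "subfield P R" and G: "monoid G"
    and sf: "stably_finite (group_ring (R\<lparr>carrier := P\<rparr>) G)"
  shows "stably_finite (group_ring R G)"
proof (rule stably_finite_if_locally_represented[OF field_axioms G])
  fix E assume "finite E" "E \<subseteq> carrier R"
  then have "\<exists>L. subfield L R \<and> E \<subseteq> L \<and> stably_finite (group_ring (R\<lparr>carrier := L\<rparr>) G)"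
  proof (induction E rule: finite_induct)
    case empty
    then show ?case using P sf by blast
  next
    case (insert x E)
    then obtain K where K: "subfield K R" "E \<subseteq> K" "stably_finite (group_ring (R\<lparr>carrier := K\<rparr>) G)"
      by auto
    then show ?case
      using stably_finite_adjoin[OF K(1) _ G K(3), of x] insert.prems by blast
  qed
  then obtain L where L: "subfield L R" "E \<subseteq> L" "stably_finite (group_ring (R\<lparr>carrier := L\<rparr>) G)"
    by blast
  have field_L: "field (R\<lparr>carrier := L\<rparr>)" by (rule subfield_iff(2)[OF L(1)])
  interpret L: field "R\<lparr>carrier := L\<rparr>" by (rule field_L)
  have "(\<lambda>a. a) \<in> Ring.ring_hom (R\<lparr>carrier := L\<rparr>) (R\<lparr>carrier := L\<rparr>)"
    by (rule ring_hom_memI) auto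
  from matrix_rep_hom[OF this L.ring_axioms]
  show "\<exists>(K :: ('a, 'b) ring_scheme) S n \<rho>. E \<subseteq> S \<and> subring S R \<and> n \<ge> 1 \<and> field K \<and>
      stably_finite (group_ring K G) \<and> matrix_rep (R\<lparr>carrier := S\<rparr>) K n \<rho>"
    using L field_L subfieldE(1)[OF L(1)]
    by (intro exI[of _ "R\<lparr>carrier := L\<rparr>"] exI[of _ L] exI[of _ "1::nat"] exI[of _ "\<lambda>a i j. a"] conjI order_refl)
qed

section \<open>The prime field\<close>

lemma ring_char_add_pow_one:
  assumes "ring_char R = p" "p > 0"
  shows "[p] \<cdot>\<^bsub>R\<^esub> \<one>\<^bsub>R\<^esub> = \<zero>\<^bsub>R\<^esub>"
proof -
  have ex: "\<exists>n::nat. n > 0 \<and> [n] \<cdot>\<^bsub>R\<^esub> \<one>\<^bsub>R\<^esub> = \<zero>\<^bsub>R\<^esub>"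
    using assms by (auto simp: ring_char_def split: if_splits)
  then have "p = (LEAST n::nat. n > 0 \<and> [n] \<cdot>\<^bsub>R\<^esub> \<one>\<^bsub>R\<^esub> = \<zero>\<^bsub>R\<^esub>)"
    using assms(1) by (simp add: ring_char_def)
  then show ?thesis using LeastI_ex[OF ex] by simp
qed

text \<open>
  The characteristic annihilates the unit, so the integer multiples of the unit depend only on the
  residue modulo \<open>p\<close>.
\<close>

lemma (in ring) residue_ring_hom:
  assumes "ring_char R = p" "p > 1"
  shows "(\<lambda>k. [k] \<cdot> \<one>) \<in> Ring.ring_hom (residue_ring (int p)) R"
proof -
  have p0: "[(int p)] \<cdot> \<one> = \<zero>"
    using ring_char_add_pow_one[of R p] assms by (simp add: add_pow_int_ge)
  have add: "[(k + l)] \<cdot> \<one> = [k] \<cdot> \<one> \<oplus> [l] \<cdot> \<one>" for k l :: int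
    by (rule add.int_pow_mult) simp
  have mult: "[(k * l)] \<cdot> \<one> = [k] \<cdot> \<one> \<otimes> [l] \<cdot> \<one>" for k l :: int
    using add_pow_ldistr_int[of \<one> "[l] \<cdot> \<one>" k] add.int_pow_pow[of \<one> k l] by (simp add: mult.commute)
  have "[(k mod int p)] \<cdot> \<one> = [k] \<cdot> \<one>" for k :: int
  proof -
    have "[k] \<cdot> \<one> = [(int p * (k div int p) + k mod int p)] \<cdot> \<one>" by simp
    also have "\<dots> = [(k mod int p)] \<cdot> \<one>" unfolding add mult p0 by simp
    finally show ?thesis ..
  qed
  then show ?thesis
    by (intro ring_hom_memI) (simp_all add: residue_ring_def add mult add_pow_int_ge)
qed

text \<open>
  Descent along the embedding of the prime field, and ascent from its image.
\<close>

lemma stably_finite_iff_prime_field: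
  assumes "field F" "prime p" "ring_char F = p" "monoid G"
  shows "stably_finite (group_ring F G) \<longleftrightarrow> stably_finite (group_ring (residue_ring (int p)) G)"
proof -
  interpret F: field F by fact
  interpret P: residues_prime p "residue_ring (int p)"
    by unfold_locales fact
  define \<phi> where "\<phi> = (\<lambda>k::int. [k] \<cdot>\<^bsub>F\<^esub> \<one>\<^bsub>F\<^esub>)"
  have \<phi>: "\<phi> \<in> Ring.ring_hom (residue_ring (int p)) F"
    unfolding \<phi>_def by (rule F.residue_ring_hom) (use assms(2,3) prime_gt_1_nat in auto)
  show ?thesis
  proof
    assume "stably_finite (group_ring F G)"
    then show "stably_finite (group_ring (residue_ring (int p)) G)"
      by (rule stably_finite_via_hom[OF P.is_field assms(1,4) \<phi>])
  next
    assume sf: "stably_finite (group_ring (residue_ring (int p)) G)"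
    have hom: "ring_hom_ring (residue_ring (int p)) F \<phi>"
      by (rule ring_hom_ringI2[OF P.ring_axioms F.ring_axioms \<phi>])
    have "stably_finite (group_ring (residue_ring (int p)\<lparr>carrier := carrier (residue_ring (int p))\<rparr>) G)"
      using sf by simp
    note image = stably_finite_image_subfield[OF hom P.carrier_is_subfield F.one_not_zero assms(4) this]
    show "stably_finite (group_ring F G)"
      by (rule F.stably_finite_ascend[OF image(1) assms(4) image(2)])
  qed
qed

theorem corollary3p15:
  fixes p :: nat
    and F :: "('f, 'fm) ring_scheme"
    and \<Gamma> :: "('g, 'gm) monoid_scheme"
  assumes "group \<Gamma>"
    and "prime p"
    and "field F"
    and "ring_char F = p"
  shows "(stably_finite (group_ring F \<Gamma>) \<longleftrightarrow>
            stably_finite (group_ring (residue_ring (int p)) \<Gamma>)) \<and>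
         (kaplansky_stable_finiteness TYPE('h) F \<longrightarrow>
            (\<forall>K :: ('k, 'km) ring_scheme. field K \<longrightarrow> ring_char K = p \<longrightarrow>
               kaplansky_stable_finiteness TYPE('h) K))"
proof (intro conjI impI allI)
  show "stably_finite (group_ring F \<Gamma>) \<longleftrightarrow> stably_finite (group_ring (residue_ring (int p)) \<Gamma>)"
    using stably_finite_iff_prime_field[OF assms(3,2,4)] group.is_monoid[OF assms(1)] by blast
next
  fix K :: "('k, 'km) ring_scheme"
  assume "kaplansky_stable_finiteness TYPE('h) F" "field K" "ring_char K = p"
  then show "kaplansky_stable_finiteness TYPE('h) K"
    unfolding kaplansky_stable_finiteness_def
    using stably_finite_iff_prime_field[OF assms(3,2,4)]
      stably_finite_iff_prime_field[OF _ assms(2), of K] group.is_monoid by blast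
qed

end
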